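(* Given Subset Sum instances $(X_1,t_1),\ldots,(X_N,t_N)$, and writing $n=\max_i|X_i|$ and $t=\max_i t_i$, one can construct in time $(nN\log t)^{O(1)}$ a single Subset Sum instance $(X_0,t_0)$ with $|X_0|=O(nN)$ and $t_0=t\cdot(nN)^{O(1)}$ such that $(X_0,t_0)$ is a yes-instance if and only if $(X_i,t_i)$ is a yes-instance for some $i\in\{1,\ldots,N\}$.
   Context: A Subset Sum instance $(X,t)$ consists of a finite (multi)set $X$ of nonnegative integers and a target integer $t\ge 0$; it is a yes-instance if some subset of $X$ sums to exactly $t$. *)

theory Defs
  imports Complex_Main "HOL-Library.Multiset" "HOL-Library.Log_Nat"
begin

type_synonym subset_sum = "nat multiset \<times> nat"

definition yes_instance :: "subset_sum \<Rightarrow> bool" where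
  "yes_instance I \<longleftrightarrow> (\<exists>Y. Y \<subseteq># fst I \<and> sum_mset Y = snd I)"

text \<open>
  The model of computation is the random access machine: a fixed finite program works on an
  unbounded memory of cells that hold natural numbers and that can be addressed indirectly, it
  reads a finite sequence of numbers (with random access) and appends numbers to an
  output sequence. Control flow is structured. Running time follows the logarithmic cost
  criterion: every operation pays for the binary lengths of its operands, including the
  addresses it uses, so that running time is polynomially related to bit operations.
\<close>

datatype expr =
    Const nat
  | Mem expr
  | In expr
  | Add expr expr
  | Sub expr expr
  | Mul expr expr

datatype prog =
    Skip
  | Store expr expr
  | Write expr
  | Seq prog prog
  | IfLess expr expr prog prog
  | WhileLess expr expr prog

fun eval_expr :: "nat list \<Rightarrow> (nat \<Rightarrow> nat) \<Rightarrow> expr \<Rightarrow> nat" where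
  "eval_expr w m (Const k) = k"
| "eval_expr w m (Mem a) = m (eval_expr w m a)"
| "eval_expr w m (In a) = (let i = eval_expr w m a in if i < length w then w ! i else 0)"
| "eval_expr w m (Add a b) = eval_expr w m a + eval_expr w m b"
| "eval_expr w m (Sub a b) = eval_expr w m a - eval_expr w m b"
| "eval_expr w m (Mul a b) = eval_expr w m a * eval_expr w m b"

definition blen :: "nat \<Rightarrow> nat" where
  "blen k = max 1 (floorlog 2 k)"

text \<open>
  The content of a cell is not charged when it is addressed but by the operation that consumes it.
\<close>

fun cost_expr :: "nat list \<Rightarrow> (nat \<Rightarrow> nat) \<Rightarrow> expr \<Rightarrow> nat" where
  "cost_expr w m (Const k) = 0"
| "cost_expr w m (Mem a) = cost_expr w m a + blen (eval_expr w m a)"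
| "cost_expr w m (In a) = cost_expr w m a + blen (eval_expr w m a)"
| "cost_expr w m (Add a b) =
     cost_expr w m a + cost_expr w m b + blen (eval_expr w m a) + blen (eval_expr w m b)"
| "cost_expr w m (Sub a b) =
     cost_expr w m a + cost_expr w m b + blen (eval_expr w m a) + blen (eval_expr w m b)"
| "cost_expr w m (Mul a b) =
     cost_expr w m a + cost_expr w m b + blen (eval_expr w m a) + blen (eval_expr w m b)"

text \<open>
  A comparison is charged for its shorter operand only: numbers are stored with their lengths, and
  digits have to be compared only if the lengths agree. This matters for Subset Sum because the
  elements of an instance are not bounded by its target: an element that exceeds the
  target can be recognized in time polynomial in the length of the target, but it cannot
  be read completely in that time.
\<close>

definition cost_less :: "nat list \<Rightarrow> (nat \<Rightarrow> nat) \<Rightarrow> expr \<Rightarrow> expr \<Rightarrow> nat" where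
  "cost_less w m a b =
     cost_expr w m a + cost_expr w m b + min (blen (eval_expr w m a)) (blen (eval_expr w m b))"

text \<open>
  \<open>exec w P (m, out) T (m', out')\<close>: on input \<open>w\<close>, program \<open>P\<close> started with memory \<open>m\<close> and output
  \<open>out\<close> halts after time \<open>T\<close> with memory \<open>m'\<close> and output \<open>out'\<close>.
\<close>

inductive exec ::
  "nat list \<Rightarrow> prog \<Rightarrow> (nat \<Rightarrow> nat) \<times> nat list \<Rightarrow> nat \<Rightarrow> (nat \<Rightarrow> nat) \<times> nat list \<Rightarrow> bool"
  for w :: "nat list" where
  exec_Skip: "exec w Skip s 1 s"
| exec_Store: "exec w (Store a b) (m, out)
     (cost_expr w m a + cost_expr w m b + blen (eval_expr w m a) + blen (eval_expr w m b))
     (m(eval_expr w m a := eval_expr w m b), out)"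
| exec_Write: "exec w (Write a) (m, out)
     (cost_expr w m a + blen (eval_expr w m a)) (m, out @ [eval_expr w m a])"
| exec_Seq: "\<lbrakk>exec w P s T1 s'; exec w Q s' T2 s''\<rbrakk> \<Longrightarrow> exec w (Seq P Q) s (T1 + T2) s''"
| exec_IfTrue: "\<lbrakk>eval_expr w m a < eval_expr w m b; exec w P (m, out) T s'\<rbrakk> \<Longrightarrow>
     exec w (IfLess a b P Q) (m, out) (cost_less w m a b + T) s'"
| exec_IfFalse: "\<lbrakk>\<not> eval_expr w m a < eval_expr w m b; exec w Q (m, out) T s'\<rbrakk> \<Longrightarrow>
     exec w (IfLess a b P Q) (m, out) (cost_less w m a b + T) s'"
| exec_WhileFalse: "\<not> eval_expr w m a < eval_expr w m b \<Longrightarrow>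
     exec w (WhileLess a b P) (m, out) (cost_less w m a b) (m, out)"
| exec_WhileTrue: "\<lbrakk>eval_expr w m a < eval_expr w m b; exec w P (m, out) T1 s';
     exec w (WhileLess a b P) s' T2 s''\<rbrakk> \<Longrightarrow>
     exec w (WhileLess a b P) (m, out) (cost_less w m a b + T1 + T2) s''"

inductive_cases exec_SkipE: "exec w Skip s T s'"
inductive_cases exec_StoreE: "exec w (Store a b) s T s'"
inductive_cases exec_WriteE: "exec w (Write a) s T s'"
inductive_cases exec_SeqE: "exec w (Seq P Q) s T s'"
inductive_cases exec_IfLessE: "exec w (IfLess a b P Q) s T s'"
inductive_cases exec_WhileLessE: "exec w (WhileLess a b P) s T s'"

lemma exec_deterministic:
  "exec w P s T s' \<Longrightarrow> exec w P s U s'' \<Longrightarrow> U = T \<and> s'' = s'"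
proof (induction arbitrary: U s'' rule: exec.induct)
  case (exec_Skip s)
  then show ?case by (elim exec_SkipE) simp_all
next
  case (exec_Store a b m out)
  then show ?case by (elim exec_StoreE) simp_all
next
  case (exec_Write a m out)
  then show ?case by (elim exec_WriteE) simp_all
next
  case (exec_Seq P s T1 s1 Q T2 s2)
  from exec_Seq.prems obtain U1 U2 s3
    where P: "exec w P s U1 s3" and Q: "exec w Q s3 U2 s''" and U: "U = U1 + U2"
    by (rule exec_SeqE)
  have 1: "U1 = T1 \<and> s3 = s1" by (rule exec_Seq.IH(1)[OF P])
  with Q have "exec w Q s1 U2 s''" by simp
  from exec_Seq.IH(2)[OF this] 1 U show ?case by simp
next
  case (exec_IfTrue m a b P out T s' Q)
  from exec_IfTrue.prems exec_IfTrue.hyps(1) obtain U1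
    where P: "exec w P (m, out) U1 s''" and U: "U = cost_less w m a b + U1"
    by (elim exec_IfLessE) simp_all
  from exec_IfTrue.IH[OF P] U show ?case by simp
next
  case (exec_IfFalse m a b Q out T s' P)
  from exec_IfFalse.prems exec_IfFalse.hyps(1) obtain U1
    where Q: "exec w Q (m, out) U1 s''" and U: "U = cost_less w m a b + U1"
    by (elim exec_IfLessE) simp_all
  from exec_IfFalse.IH[OF Q] U show ?case by simp
next
  case (exec_WhileFalse m a b P out)
  from exec_WhileFalse.prems show ?case
    by (rule exec_WhileLessE) (use exec_WhileFalse.hyps in simp_all)
next
  case (exec_WhileTrue m a b P out T1 s1 T2 s2)
  from exec_WhileTrue.prems obtain U1 s3 U2
    where P: "exec w P (m, out) U1 s3" and W: "exec w (WhileLess a b P) s3 U2 s''"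
      and U: "U = cost_less w m a b + U1 + U2"
    by (rule exec_WhileLessE) (use exec_WhileTrue.hyps(1) in simp_all)
  have 1: "U1 = T1 \<and> s3 = s1" by (rule exec_WhileTrue.IH(1)[OF P])
  with W have "exec w (WhileLess a b P) s1 U2 s''" by simp
  from exec_WhileTrue.IH(2)[OF this] 1 U show ?case by simp
qed

definition computes_in :: "prog \<Rightarrow> nat list \<Rightarrow> nat \<Rightarrow> nat list \<Rightarrow> bool" where
  "computes_in P w T v \<longleftrightarrow> (\<exists>m. exec w P (\<lambda>_. 0, []) T (m, v))"

text \<open>
  An instance is given by its target, the number of its elements, and the elements in
  an arbitrary order.
\<close>

definition encodes :: "nat list \<Rightarrow> subset_sum \<Rightarrow> bool" where
  "encodes w I \<longleftrightarrow> (\<exists>xs. mset xs = fst I \<and> w = snd I # length xs # xs)"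

definition encodes_list :: "nat list \<Rightarrow> subset_sum list \<Rightarrow> bool" where
  "encodes_list w Is \<longleftrightarrow> (\<exists>ws. list_all2 encodes ws Is \<and> w = length Is # concat ws)"

end

theory Submission
  imports Defs
begin

text \<open>
  Attach the tag \<open>(1, i, i\<^sup>2)\<close> to every element of the \<open>i\<close>-th instance and to \<open>n\<close> additional
  dummy elements 0, and add one selector per instance. The tags are written in front
  of the values as digits to a base so large that no carries occur. The digits of the target force
  a solution to contain exactly one selector, say of instance \<open>k\<close>, and exactly \<open>n\<close> tagged elements;
  the selector reduces the remaining demand on the other two digits to \<open>n * k\<close> and \<open>n * k\<^sup>2\<close>.
  Points of a parabola are in convex position, so all the tagged elements come from instance \<open>k\<close>.
  The value of the selector is \<open>t - t\<^sub>k\<close>, so the values of the other elements sum to \<open>t\<^sub>k\<close>.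
  Instances with a target 0 and the case \<open>n = 0\<close> are treated separately, since
  \<open>t = 0\<close> and \<open>n = 0\<close> leave no room for tags and selectors. An element above \<open>t\<close> may be too long to
  be read and is replaced by a dummy.
\<close>

section \<open>Running time\<close>

lemma blen_le_iff: "0 < d \<Longrightarrow> blen k \<le> d \<longleftrightarrow> k < 2 ^ d"
  by (auto simp: blen_def floorlog_le_iff)

lemma blen_pos: "0 < blen k"
  by (simp add: blen_def)

lemma less_pow_blen: "k < 2 ^ blen k"
  using blen_le_iff[of "blen k" k] blen_pos[of k] by simp

lemma blen_mono: "j \<le> k \<Longrightarrow> blen j \<le> blen k"
  by (auto simp: blen_def intro!: floorlog_mono le_max_iff_disj[THEN iffD2])

text \<open>\<open>Suc j * Suc k\<close> exceeds \<open>j + k\<close>, so a sum can be estimated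
  like a product. The crude bound lets addition and multiplication be treated alike below.\<close>

lemma blen_add: "blen (j + k) \<le> blen j + blen k"
proof -
  have "Suc j \<le> 2 ^ blen j" "Suc k \<le> 2 ^ blen k"
    using less_pow_blen by (auto simp: Suc_le_eq)
  then have "Suc j * Suc k \<le> 2 ^ blen j * 2 ^ blen k"
    by (rule mult_le_mono)
  then have "j + k < 2 ^ (blen j + blen k)"
    by (simp add: power_add)
  then show ?thesis
    using blen_le_iff blen_pos by simp
qed

lemma blen_mult: "blen (j * k) \<le> blen j + blen k"
proof -
  have "j * k < 2 ^ blen j * 2 ^ blen k"
    using less_pow_blen by (intro mult_strict_mono) auto
  then show ?thesis
    using blen_le_iff blen_pos by (simp add: power_add)
qed

lemma blen_le_self: "0 < k \<Longrightarrow> blen k \<le> k"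
  by (simp add: blen_le_iff)

text \<open>The length of a positive number is its rounded-down logarithm plus 1; the factor 2
  absorbs the 1.\<close>

lemma blen_le_log: "real (blen k) \<le> 2 * max 1 (log 2 (real k))"
proof (cases "k = 0")
  case False
  then have "0 \<le> log 2 (real k)"
    by simp
  then have "real (blen k) \<le> log 2 (real k) + 1"
    using False by (simp add: blen_def floorlog_def)
  then show ?thesis
    by linarith
qed (simp add: blen_def floorlog_def)

section \<open>Cost of evaluating expressions\<close>

fun esize :: "expr \<Rightarrow> nat" where
  "esize (Const k) = 1"
| "esize (Mem a) = esize a + 1"
| "esize (In a) = esize a + 1"
| "esize (Add a b) = esize a + esize b + 1"
| "esize (Sub a b) = esize a + esize b + 1"
| "esize (Mul a b) = esize a + esize b + 1"

text \<open>Only constants and fetched contents are limited to \<open>d\<close> bits; the length of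
  intermediate results then follows from the size of the expression.\<close>

fun short :: "nat list \<Rightarrow> nat \<Rightarrow> (nat \<Rightarrow> nat) \<Rightarrow> expr \<Rightarrow> bool" where
  "short w d m (Const k) \<longleftrightarrow> blen k \<le> d"
| "short w d m (Mem a) \<longleftrightarrow> short w d m a \<and> blen (m (eval_expr w m a)) \<le> d"
| "short w d m (In a) \<longleftrightarrow> short w d m a \<and> blen (eval_expr w m (In a)) \<le> d"
| "short w d m (Add a b) \<longleftrightarrow> short w d m a \<and> short w d m b"
| "short w d m (Sub a b) \<longleftrightarrow> short w d m a \<and> short w d m b"
| "short w d m (Mul a b) \<longleftrightarrow> short w d m a \<and> short w d m b"

text \<open>Input numbers may be arbitrarily long, so the last operand of a comparison is exempt.\<close>

fun short_operands :: "nat list \<Rightarrow> nat \<Rightarrow> (nat \<Rightarrow> nat) \<Rightarrow> expr \<Rightarrow> bool" where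
  "short_operands w d m (In a) \<longleftrightarrow> short w d m a"
| "short_operands w d m a \<longleftrightarrow> short w d m a"

lemma short_imp_short_operands: "short w d m a \<Longrightarrow> short_operands w d m a"
  by (cases a) simp_all

text \<open>Lengths add up under \<open>Add\<close> and \<open>Mul\<close> and do not grow under
  \<open>Sub\<close>, so every leaf or fetch contributes at most \<open>d\<close>.\<close>

lemma blen_eval_le:
  assumes "short w d m a"
  shows "blen (eval_expr w m a) \<le> esize a * d"
  using assms
proof (induction a)
  case (Add a b)
  then show ?case
    using blen_add[of "eval_expr w m a" "eval_expr w m b"] by (simp add: add_mult_distrib)
next
  case (Sub a b)
  then show ?case
    using blen_mono[of "eval_expr w m a - eval_expr w m b" "eval_expr w m a"]
    by (simp add: add_mult_distrib)
next
  case (Mul a b)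
  then show ?case
    using blen_mult[of "eval_expr w m a" "eval_expr w m b"] by (simp add: add_mult_distrib)
qed auto

text \<open>At most \<open>esize a\<close> operations each pay for operands of length linear in
  \<open>esize a * d\<close>, hence the square.\<close>

lemma cost_expr_le:
  assumes "short_operands w d m a"
  shows "cost_expr w m a \<le> (esize a)\<^sup>2 * d"
proof -
  have *: "short w d m a \<Longrightarrow> cost_expr w m a \<le> (esize a)\<^sup>2 * d" for a
  proof (induction a)
    case (Const k)
    then show ?case by simp
  next
    case (Mem a)
    then show ?case
      using blen_eval_le[of w d m a] by (simp add: power2_eq_square algebra_simps)
  next
    case (In a)
    then show ?case
      using blen_eval_le[of w d m a] by (simp add: power2_eq_square algebra_simps)
  next
    case (Add a b)
    then show ?case
      using blen_eval_le[of w d m a] blen_eval_le[of w d m b]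
      by (simp add: power2_eq_square algebra_simps)
  next
    case (Sub a b)
    then show ?case
      using blen_eval_le[of w d m a] blen_eval_le[of w d m b]
      by (simp add: power2_eq_square algebra_simps)
  next
    case (Mul a b)
    then show ?case
      using blen_eval_le[of w d m a] blen_eval_le[of w d m b]
      by (simp add: power2_eq_square algebra_simps)
  qed
  \<comment> \<open>An outermost \<open>In\<close> pays for its address only, so the length of the
    number fetched does not enter.\<close>
  show ?thesis
  proof (cases "\<exists>b. a = In b")
    case True
    then obtain b where "a = In b" ..
    then show ?thesis
      using assms *[of b] blen_eval_le[of w d m b] by (simp add: power2_eq_square algebra_simps)
  next
    case False
    then show ?thesis
      using assms *[of a] by (cases a) simp_all
  qed
qed

text \<open>The shorter operand is at most as long as the first one, so an arbitrarily long input
  number on the right is harmless.\<close>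

lemma cost_less_le:
  assumes "short w d m a" "short_operands w d m b"
  shows "cost_less w m a b \<le> (esize a + esize b)\<^sup>2 * d"
proof -
  have "cost_less w m a b \<le> (esize a)\<^sup>2 * d + (esize b)\<^sup>2 * d + esize a * d"
    unfolding cost_less_def
    by (intro add_mono cost_expr_le assms short_imp_short_operands blen_eval_le
        order_trans[OF min.cobounded1])
  also have "\<dots> \<le> (esize a + esize b)\<^sup>2 * d"
  proof -
    \<comment> \<open>The mixed term of the square absorbs the linear term
      \<open>esize a\<close>.\<close>
    have "1 \<le> esize b" by (cases b) auto
    then have "esize a \<le> esize a * esize b" by simp
    then have "(esize a)\<^sup>2 + (esize b)\<^sup>2 + esize a \<le> (esize a + esize b)\<^sup>2"
      unfolding power2_sum by linarith
    then show ?thesis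
      by (metis add_mult_distrib mult_le_mono1)
  qed
  finally show ?thesis .
qed

section \<open>Execution within a time bound\<close>

definition runs ::
  "nat list \<Rightarrow> prog \<Rightarrow> (nat \<Rightarrow> nat) \<times> nat list \<Rightarrow> nat \<Rightarrow> (nat \<Rightarrow> nat) \<times> nat list \<Rightarrow> bool"
where
  "runs w P s k s' \<longleftrightarrow> (\<exists>T\<le>k. exec w P s T s')"

lemma runs_mono: "runs w P s k s' \<Longrightarrow> k \<le> l \<Longrightarrow> runs w P s l s'"
  unfolding runs_def by (blast intro: order_trans)

lemma runs_Seq:
  assumes "runs w P s j s'" "runs w Q s' k s''" "j + k \<le> l"
  shows "runs w (Seq P Q) s l s''"
proof -
  from assms obtain T1 T2 where "T1 \<le> j" "exec w P s T1 s'" "T2 \<le> k" "exec w Q s' T2 s''"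
    by (auto simp: runs_def)
  then show ?thesis
    using assms(3) unfolding runs_def
    by (intro exI[of _ "T1 + T2"]) (auto intro: exec_Seq)
qed

lemma runs_If:
  assumes "short w d m a" "short_operands w d m b"
    and "eval_expr w m a < eval_expr w m b \<Longrightarrow> runs w P (m, out) k s"
    and "\<not> eval_expr w m a < eval_expr w m b \<Longrightarrow> runs w Q (m, out) k s"
    and "(esize a + esize b)\<^sup>2 * d + k \<le> l"
  shows "runs w (IfLess a b P Q) (m, out) l s"
proof (cases "eval_expr w m a < eval_expr w m b")
  case True
  with assms(3) obtain T where "T \<le> k" "exec w P (m, out) T s"
    by (auto simp: runs_def)
  with True show ?thesis
    using cost_less_le[OF assms(1,2)] assms(5) unfolding runs_def
    by (intro exI[of _ "cost_less w m a b + T"]) (auto intro: exec_IfTrue)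
next
  case False
  with assms(4) obtain T where "T \<le> k" "exec w Q (m, out) T s"
    by (auto simp: runs_def)
  with False show ?thesis
    using cost_less_le[OF assms(1,2)] assms(5) unfolding runs_def
    by (intro exI[of _ "cost_less w m a b + T"]) (auto intro: exec_IfFalse)
qed

text \<open>\<open>M i\<close> and \<open>out i\<close> are the invariant after \<open>i\<close>
  rounds, given as explicit states; \<open>Suc k\<close> tests are paid because the last one
  fails.\<close>

lemma runs_While:
  assumes "\<And>i. i \<le> k \<Longrightarrow> short w d (M i) a \<and> short_operands w d (M i) b"
    and "\<And>i. i < k \<Longrightarrow> eval_expr w (M i) a < eval_expr w (M i) b"
    and "\<And>i. i < k \<Longrightarrow> runs w P (M i, out i) c (M (Suc i), out (Suc i))"
    and "\<not> eval_expr w (M k) a < eval_expr w (M k) b"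
    and "k * c + Suc k * ((esize a + esize b)\<^sup>2 * d) \<le> l"
  shows "runs w (WhileLess a b P) (M 0, out 0) l (M k, out k)"
proof -
  let ?g = "(esize a + esize b)\<^sup>2 * d"
  \<comment> \<open>Induction on the number \<open>i\<close> of rounds still to come, since the rule
    for loops unrolls the first round.\<close>
  have "i \<le> k \<Longrightarrow>
      runs w (WhileLess a b P) (M (k - i), out (k - i)) (i * c + Suc i * ?g) (M k, out k)" for i
  proof (induction i)
    case 0
    then show ?case
      using assms(1)[of k] assms(4) cost_less_le[of w d "M k" a b] unfolding runs_def
      by (intro exI[of _ "cost_less w (M k) a b"]) (auto intro: exec_WhileFalse)
  next
    case (Suc i)
    let ?j = "k - Suc i"
    have j: "?j < k" "Suc ?j = k - i" using Suc.prems by auto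
    from assms(3)[OF j(1)] j(2) obtain T1
      where 1: "T1 \<le> c" "exec w P (M ?j, out ?j) T1 (M (k - i), out (k - i))"
      by (auto simp: runs_def)
    from Suc obtain T2 where 2: "T2 \<le> i * c + Suc i * ?g"
      "exec w (WhileLess a b P) (M (k - i), out (k - i)) T2 (M k, out k)"
      by (auto simp: runs_def)
    have "cost_less w (M ?j) a b \<le> ?g"
      using assms(1)[of ?j] by (intro cost_less_le) auto
    then have "cost_less w (M ?j) a b + T1 + T2 \<le> Suc i * c + Suc (Suc i) * ?g"
      using 1(1) 2(1) by simp
    moreover have "exec w (WhileLess a b P) (M ?j, out ?j)
        (cost_less w (M ?j) a b + T1 + T2) (M k, out k)"
      using assms(2)[OF j(1)] 1(2) 2(2) by (rule exec_WhileTrue)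
    ultimately show ?case
      unfolding runs_def by blast
  qed
  from this[of k] have "runs w (WhileLess a b P) (M 0, out 0) (k * c + Suc k * ?g) (M k, out k)"
    by simp
  then obtain T where "T \<le> k * c + Suc k * ?g"
    "exec w (WhileLess a b P) (M 0, out 0) T (M k, out k)"
    unfolding runs_def by (elim exE conjE)
  with assms(5) show ?thesis
    unfolding runs_def by (intro exI[of _ T] conjI) (erule order_trans)
qed

section \<open>Loop-free programs\<close>

fun loop_free :: "prog \<Rightarrow> bool" where
  "loop_free (Seq P Q) \<longleftrightarrow> loop_free P \<and> loop_free Q"
| "loop_free (IfLess a b P Q) \<longleftrightarrow> loop_free P \<and> loop_free Q"
| "loop_free (WhileLess a b P) \<longleftrightarrow> False"
| "loop_free P \<longleftrightarrow> True"

text \<open>A functional semantics that the simplifier can evaluate symbolically. Mapping a loop to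
  the identity is a default value; \<open>loop_free\<close> excludes it.\<close>

fun sem :: "nat list \<Rightarrow> prog \<Rightarrow> (nat \<Rightarrow> nat) \<times> nat list \<Rightarrow> (nat \<Rightarrow> nat) \<times> nat list" where
  "sem w (Store a b) (m, out) = (m(eval_expr w m a := eval_expr w m b), out)"
| "sem w (Write a) (m, out) = (m, out @ [eval_expr w m a])"
| "sem w (Seq P Q) s = sem w Q (sem w P s)"
| "sem w (IfLess a b P Q) (m, out) =
     (if eval_expr w m a < eval_expr w m b then sem w P (m, out) else sem w Q (m, out))"
| "sem w P s = s"

fun short_prog :: "nat list \<Rightarrow> nat \<Rightarrow> prog \<Rightarrow> (nat \<Rightarrow> nat) \<times> nat list \<Rightarrow> bool" where
  "short_prog w d (Store a b) (m, out) \<longleftrightarrow> short w d m a \<and> short w d m b"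
| "short_prog w d (Write a) (m, out) \<longleftrightarrow> short w d m a"
| "short_prog w d (Seq P Q) s \<longleftrightarrow> short_prog w d P s \<and> short_prog w d Q (sem w P s)"
| "short_prog w d (IfLess a b P Q) (m, out) \<longleftrightarrow>
     short w d m a \<and> short_operands w d m b \<and>
     (if eval_expr w m a < eval_expr w m b then short_prog w d P (m, out)
      else short_prog w d Q (m, out))"
| "short_prog w d P s \<longleftrightarrow> True"

text \<open>The added 1 under the squares leaves room for the operand lengths that
  \<open>Store\<close> and \<open>Write\<close> pay beyond evaluation.\<close>

fun psize :: "prog \<Rightarrow> nat" where
  "psize (Store a b) = (esize a + esize b + 1)\<^sup>2"
| "psize (Write a) = (esize a + 1)\<^sup>2"
| "psize (Seq P Q) = psize P + psize Q"
| "psize (IfLess a b P Q) = (esize a + esize b)\<^sup>2 + psize P + psize Q"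
| "psize P = 1"

lemma runs_loop_free:
  assumes "loop_free P" "short_prog w d P s" "0 < d"
  shows "runs w P s (psize P * d) (sem w P s)"
  using assms(1,2)
proof (induction P arbitrary: s)
  case Skip
  with \<open>0 < d\<close> show ?case
    using exec_Skip[of w s] unfolding runs_def by (intro exI[of _ 1]) simp
next
  case (Store a b)
  obtain m out where s: "s = (m, out)" by fastforce
  with Store have sh: "short w d m a" "short w d m b" by auto
  then have "cost_expr w m a + cost_expr w m b + blen (eval_expr w m a) + blen (eval_expr w m b)
      \<le> (esize a)\<^sup>2 * d + (esize b)\<^sup>2 * d + esize a * d + esize b * d"
    by (intro add_mono cost_expr_le blen_eval_le short_imp_short_operands sh)
  also have "\<dots> \<le> psize (Store a b) * d"
    by (simp add: power2_eq_square algebra_simps)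
  finally show ?case
    unfolding s runs_def by (auto intro: exec_Store)
next
  case (Write a)
  obtain m out where s: "s = (m, out)" by fastforce
  with Write have sh: "short w d m a" by auto
  then have "cost_expr w m a + blen (eval_expr w m a) \<le> (esize a)\<^sup>2 * d + esize a * d"
    by (intro add_mono cost_expr_le blen_eval_le short_imp_short_operands sh)
  also have "\<dots> \<le> psize (Write a) * d"
    by (simp add: power2_eq_square algebra_simps)
  finally show ?case
    unfolding s runs_def by (auto intro: exec_Write)
next
  case (Seq P Q)
  then show ?case
    by (auto intro!: runs_Seq[OF Seq.IH] simp: add_mult_distrib)
next
  case (IfLess a b P Q)
  obtain m out where s: "s = (m, out)" by fastforce
  show ?case
    unfolding s
  proof (rule runs_If[where d = d and k = "(psize P + psize Q) * d"])
    show "runs w P (m, out) ((psize P + psize Q) * d) (sem w (IfLess a b P Q) (m, out))"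
      if "eval_expr w m a < eval_expr w m b"
      using IfLess.prems IfLess.IH(1)[of "(m, out)"] that s
      by (auto intro: runs_mono)
    show "runs w Q (m, out) ((psize P + psize Q) * d) (sem w (IfLess a b P Q) (m, out))"
      if "\<not> eval_expr w m a < eval_expr w m b"
      using IfLess.prems IfLess.IH(2)[of "(m, out)"] that s
      by (auto intro: runs_mono)
  qed (use IfLess.prems s in \<open>auto simp: algebra_simps\<close>)
qed simp

text \<open>A finite list of registers represents the memory, so that a write becomes a list update
  that simplification can carry out.\<close>

definition mem :: "nat list \<Rightarrow> nat \<Rightarrow> nat" where
  "mem vs a = (if a < length vs then vs ! a else 0)"

lemma mem_upd: "a < length vs \<Longrightarrow> (mem vs)(a := v) = mem (vs[a := v])"
  by (auto simp: mem_def fun_eq_iff)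

lemma list_update_numeral: "(x # xs)[numeral k := v] = x # xs[pred_numeral k := v]"
  by (simp add: numeral_eq_Suc)

section \<open>Correctness of the composition\<close>

fun pmax :: "(nat \<Rightarrow> nat) \<Rightarrow> nat \<Rightarrow> nat" where
  "pmax f 0 = 0"
| "pmax f (Suc i) = (if pmax f i < f i then f i else pmax f i)"

lemma pmax_mono: "i \<le> j \<Longrightarrow> pmax f i \<le> pmax f j"
  by (induction rule: dec_induct) auto

lemma le_pmax: "i < j \<Longrightarrow> f i \<le> pmax f j"
  using pmax_mono[of "Suc i" j f] by (auto split: if_splits)

text \<open>Connects the maximum that a scan updates step by step with the \<open>Max\<close> of the
  theorem.\<close>

lemma Max_eq_pmax: "0 < j \<Longrightarrow> Max (f ` {..<j}) = pmax f j"
proof (induction j)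
  case (Suc j)
  then show ?case
    by (cases "j = 0") (simp_all add: lessThan_Suc max_def lessThan_empty_iff)
qed simp

lemma upt_split: "k < N \<Longrightarrow> [0..<N] = [0..<k] @ k # [Suc k..<N]"
  by (metis less_imp_le_nat upt_add_eq_append upt_conv_Cons le0 le_Suc_ex)

lemma digits_unique:
  fixes B :: nat
  assumes "u + B * x = v + B * y" "u < B" "v < B"
  shows "u = v \<and> x = y"
proof -
  have "(u + B * x) mod B = u" "(u + B * x) div B = x" using assms(2) by auto
  moreover have "(v + B * y) mod B = v" "(v + B * y) div B = y" using assms(3) by auto
  ultimately show ?thesis using assms(1) by simp
qed

lemma sum_mset_le_size_mult:
  fixes f :: "'a \<Rightarrow> nat"
  shows "(\<And>x. x \<in># A \<Longrightarrow> f x \<le> k) \<Longrightarrow> (\<Sum>x\<in>#A. f x) \<le> size A * k"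
proof (induction A)
  case (add x A)
  then show ?case by (auto intro: add_mono)
qed simp

text \<open>The variance vanishes: expanding the squared deviations from \<open>k\<close> with the
  two given sums yields 0, so every deviation is 0.\<close>

lemma mean_on_parabola:
  fixes f :: "'a \<Rightarrow> nat"
  assumes "(\<Sum>x\<in>#R. f x) = size R * k" "(\<Sum>x\<in>#R. f x * f x) = size R * (k * k)" "x \<in># R"
  shows "f x = k"
proof -
  \<comment> \<open>This is the squared deviation in natural numbers: with truncated subtraction, at
    least one of the two products is 0.\<close>
  define g where "g x = (f x - k) * (f x - k) + (k - f x) * (k - f x)" for x
  have "f x * f x + k * k = 2 * k * f x + g x" for x
  proof (cases "f x \<le> k")
    case True
    then obtain d where "k = f x + d" using le_Suc_ex by blast
    then show ?thesis by (simp add: g_def algebra_simps)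
  next
    case False
    then obtain d where "f x = k + d" using le_Suc_ex nat_le_linear by blast
    then show ?thesis by (simp add: g_def algebra_simps)
  qed
  then have "(\<Sum>x\<in>#R. f x * f x + k * k) = (\<Sum>x\<in>#R. 2 * k * f x + g x)"
    by simp
  also have "\<dots> = 2 * k * (\<Sum>x\<in>#R. f x) + (\<Sum>x\<in>#R. g x)"
    by (simp add: sum_mset.distrib sum_mset_distrib_left)
  finally have "(\<Sum>x\<in>#R. g x) = 0"
    using assms(1,2) by (simp add: sum_mset.distrib)
  then have "g x = 0" using assms(3) by simp
  then show ?thesis by (simp add: g_def)
qed

text \<open>Lifts a choice of numbers to a choice of labelled elements, one preimage at a
  time.\<close>

lemma subset_image_mset:
  "Y \<subseteq># image_mset f A \<Longrightarrow> \<exists>X. X \<subseteq># A \<and> Y = image_mset f X"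
proof (induction A arbitrary: Y)
  case (add x A)
  show ?case
  proof (cases "f x \<in># Y")
    case True
    then have "Y - {#f x#} \<subseteq># image_mset f A"
      using add.prems by (simp add: subset_eq_diff_conv)
    with add.IH obtain X where "X \<subseteq># A" "Y - {#f x#} = image_mset f X" by blast
    then show ?thesis
      using True by (intro exI[of _ "add_mset x X"])
        (metis image_mset_add_mset insert_DiffM mset_subset_eq_add_mset_cancel)
  next
    case False
    then have "Y \<subseteq># image_mset f A"
      using add.prems by (simp add: subset_mset.inf.absorb_iff2 inter_add_left1)
    with add.IH obtain X where "X \<subseteq># A" "Y = image_mset f X" by blast
    moreover have "A \<subseteq># add_mset x A"
      by simp
    ultimately show ?thesis
      using subset_mset.order_trans by blast
  qed
qed simp

section \<open>The composed instance\<close>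

locale or_composition =
  fixes N :: nat and tg :: "nat \<Rightarrow> nat" and xs :: "nat \<Rightarrow> nat list"
  assumes N_pos: "0 < N"
begin

definition t :: nat where "t = pmax tg N"
definition n :: nat where "n = pmax (\<lambda>i. length (xs i)) N"
text \<open>For \<open>0 < n\<close>, fewer than \<open>4 * n * N\<close> elements can be chosen,
  and the digits that need a bound are at most \<open>n * (N * N)\<close>; the product of these is
  \<open>M\<close>. The lowest digit holds values up to \<open>t\<close> and gets its own base
  \<open>B\<close>.\<close>

definition M :: nat where "M = 4 * n * n * N * N * N"
definition B :: nat where "B = t * M"

text \<open>Digits from the lowest: value, instance, its square, number of tagged elements, number
  of selectors. In \<open>tag\<close>, \<open>selector\<close> and \<open>goal\<close> the trailing
  \<open>M\<close>, \<open>M * M\<close> and \<open>M\<close> stand for a leading digit 1.\<close>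

definition tag :: "nat \<Rightarrow> nat" where
  "tag i = B * (i + M * (i * i + M))"

definition selector :: "nat \<Rightarrow> nat" where
  "selector i = (t - tg i) + B * (n * (N - i) + M * (n * (N * N - i * i) + M * M))"

definition goal :: nat where
  "goal = t + B * (n * N + M * (n * (N * N) + M * (n + M)))"

definition block :: "nat \<Rightarrow> nat list" where
  "block i = selector i # replicate n (tag i) @ map (\<lambda>x. if t < x then tag i else tag i + x) (xs i)"

definition elems :: "nat list" where
  "elems = concat (map block [0..<N])"

lemma tg_le: "i < N \<Longrightarrow> tg i \<le> t"
  unfolding t_def by (rule le_pmax)

lemma length_le: "i < N \<Longrightarrow> length (xs i) \<le> n"
  unfolding n_def by (rule le_pmax[where f = "\<lambda>i. length (xs i)"])

lemma length_elems_le: "length elems \<le> N * (2 * n + 1)"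
proof -
  have "length elems = (\<Sum>i\<leftarrow>[0..<N]. length (block i))"
    by (simp add: elems_def length_concat o_def)
  also have "\<dots> \<le> (\<Sum>i\<leftarrow>[0..<N]. 2 * n + 1)"
    using length_le by (intro sum_list_mono) (fastforce simp: block_def)
  finally show ?thesis
    by (simp add: sum_list_triv)
qed

text \<open>The base \<open>B\<close> contains the factor \<open>t\<close>, so \<open>t\<close> can
  be pulled out of the whole number. Bounding the middle digits by \<open>M\<close> leaves a
  polynomial of degree 4 in \<open>M\<close>.\<close>

lemma goal_le: "goal \<le> t * (5 * M ^ 4 + 1)" if "0 < n"
proof -
  have N: "1 \<le> N" "1 \<le> n" using N_pos that by auto
  have M1: "1 \<le> M" using N by (simp add: M_def)
  have "n * (N * N) \<le> n * (N * N) * (4 * n * N)" using N by simp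
  then have 1: "n * (N * N) \<le> M" by (simp add: M_def mult_ac)
  have "n * N \<le> n * N * (4 * n * N * N)" using N by simp
  then have 2: "n * N \<le> M" by (simp add: M_def mult_ac)
  have "n \<le> n * (4 * n * N * N * N)" using N by simp
  then have 3: "n \<le> M" by (simp add: M_def mult_ac)
  have "goal \<le> t + B * (M + M * (M + M * (M + M)))"
    unfolding goal_def by (intro add_mono mult_mono order_refl 1 2 3) auto
  also have "\<dots> = t * (1 + (M ^ 2 + M ^ 3 + 2 * M ^ 4))"
    by (simp add: B_def algebra_simps power2_eq_square power3_eq_cube power4_eq_xxxx)
  also have "\<dots> \<le> t * (5 * M ^ 4 + 1)"
    using power_increasing[OF _ M1, of 2 4] power_increasing[OF _ M1, of 3 4]
    by (intro mult_le_mono2) simp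
  finally show ?thesis .
qed

section \<open>Digits of labelled elements\<close>

fun digit0 :: "bool \<times> nat \<times> nat \<Rightarrow> nat" where
  "digit0 (s, i, v) = v"
fun digit1 :: "bool \<times> nat \<times> nat \<Rightarrow> nat" where
  "digit1 (s, i, v) = (if s then n * (N - i) else i)"
fun digit2 :: "bool \<times> nat \<times> nat \<Rightarrow> nat" where
  "digit2 (s, i, v) = (if s then n * (N * N - i * i) else i * i)"
fun digit3 :: "bool \<times> nat \<times> nat \<Rightarrow> nat" where
  "digit3 (s, i, v) = (if s then 0 else 1)"
fun digit4 :: "bool \<times> nat \<times> nat \<Rightarrow> nat" where
  "digit4 (s, i, v) = (if s then 1 else 0)"

definition val :: "bool \<times> nat \<times> nat \<Rightarrow> nat" where
  "val x = digit0 x + B * (digit1 x + M * (digit2 x + M * (digit3 x + M * digit4 x)))"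

definition items :: "nat \<Rightarrow> (bool \<times> nat \<times> nat) list" where
  "items i = replicate n (False, i, 0) @ map (\<lambda>x. (False, i, if t < x then 0 else x)) (xs i)"

text \<open>Labels keep the origin of each number (selector or not, instance, value), so that sums
  can be split by digit and by origin; \<open>elems\<close> is the image under
  \<open>val\<close>.\<close>

definition labelled :: "(bool \<times> nat \<times> nat) list" where
  "labelled = concat (map (\<lambda>i. (True, i, t - tg i) # items i) [0..<N])"

lemma elems_eq: "elems = map val labelled"
  unfolding elems_def labelled_def map_concat map_map
  by (intro arg_cong[of _ _ concat] map_cong refl)
    (auto simp: block_def items_def val_def tag_def selector_def map_replicate_const)

lemma sum_val:
  "(\<Sum>x\<in>#A. val x) = (\<Sum>x\<in>#A. digit0 x) + B * ((\<Sum>x\<in>#A. digit1 x) +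
    M * ((\<Sum>x\<in>#A. digit2 x) + M * ((\<Sum>x\<in>#A. digit3 x) + M * (\<Sum>x\<in>#A. digit4 x))))"
  unfolding val_def by (simp add: sum_mset.distrib sum_mset_distrib_left algebra_simps)

lemma labelled_cases:
  assumes "x \<in> set labelled"
  obtains i where "i < N" "x = (True, i, t - tg i)"
  | i v where "i < N" "x = (False, i, v)" "v \<le> t"
  using assms by (auto simp: labelled_def items_def not_less split: if_splits)

lemma digit_bounds:
  assumes "x \<in> set labelled" "0 < n"
  shows "digit0 x \<le> t" "digit1 x \<le> n * (N * N)" "digit2 x \<le> n * (N * N)"
    "digit3 x \<le> n * (N * N)"
proof -
  have N: "N \<le> N * N" using N_pos by simp
  have n: "y \<le> n * (N * N)" if "y \<le> N * N" for y
    using mult_le_mono[of 1 n y "N * N"] assms(2) that by simp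
  have "i \<le> n * (N * N) \<and> i * i \<le> n * (N * N)" if "i < N" for i
  proof
    have "i \<le> N" using that by simp
    then show "i \<le> n * (N * N)" using N by (intro n) linarith
    show "i * i \<le> n * (N * N)" using \<open>i \<le> N\<close> by (intro n mult_le_mono)
  qed
  moreover have "n * (N - i) \<le> n * (N * N)" for i
    using N by (intro mult_le_mono2 order_trans[OF diff_le_self])
  moreover have "1 \<le> n * (N * N)"
    using assms(2) N_pos by simp
  ultimately show "digit0 x \<le> t" "digit1 x \<le> n * (N * N)" "digit2 x \<le> n * (N * N)"
      "digit3 x \<le> n * (N * N)"
    using assms by (auto elim!: labelled_cases)
qed

text \<open>At most \<open>N * (2 * n + 1)\<close> elements exist, which is at most
  \<open>3 * (N * n)\<close>; the constant 4 makes the bound strict.\<close>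

lemma sum_digit_less:
  assumes "A \<subseteq># mset labelled" "0 < n" "\<And>x. x \<in> set labelled \<Longrightarrow> f x \<le> k" "0 < k"
  shows "(\<Sum>x\<in>#A. f x) < 4 * n * N * k"
proof -
  have "size A \<le> N * (2 * n + 1)"
    using size_mset_mono[OF assms(1)] length_elems_le by (simp add: elems_eq)
  moreover have "N \<le> N * n" "0 < N * n" using assms(2) N_pos by auto
  ultimately have "size A < 4 * (N * n)"
    unfolding add_mult_distrib2 by linarith
  then have "size A < 4 * n * N"
    by (simp add: mult_ac)
  have "(\<Sum>x\<in>#A. f x) \<le> size A * k"
    using assms(1,3) by (intro sum_mset_le_size_mult) (metis mset_subset_eqD set_mset_mset)
  also have "\<dots> < 4 * n * N * k"
    using \<open>size A < 4 * n * N\<close> assms(4) by simp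
  finally show ?thesis .
qed

lemma filter_labelled:
  assumes "k < N"
  shows "filter (\<lambda>x. \<not> fst x \<and> fst (snd x) = k) labelled = items k"
proof -
  have *: "filter (\<lambda>x. \<not> fst x \<and> fst (snd x) = k) (items i) = (if i = k then items k else [])" for i
    by (auto simp: items_def filter_empty_conv intro!: filter_True)
  have "concat (map (\<lambda>i. if i = k then items k else []) [0..<k]) = []"
    "concat (map (\<lambda>i. if i = k then items k else []) [Suc k..<N]) = []"
    by auto
  then show ?thesis
    unfolding labelled_def upt_split[OF assms]
    by (simp add: filter_concat o_def * del: concat_eq_Nil_conv)
qed

text \<open>Every digit sum below the leading one stays below its base, as does the matching digit
  of \<open>goal\<close>. Equality therefore passes from digit to digit, starting at the
  lowest.\<close>

lemma digits_of_sum: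
  assumes A: "A \<subseteq># mset labelled" and "0 < n" "0 < t" and goal: "(\<Sum>x\<in>#A. val x) = goal"
  shows "(\<Sum>x\<in>#A. digit0 x) = t" "(\<Sum>x\<in>#A. digit1 x) = n * N"
    "(\<Sum>x\<in>#A. digit2 x) = n * (N * N)" "(\<Sum>x\<in>#A. digit3 x) = n" "(\<Sum>x\<in>#A. digit4 x) = 1"
proof -
  have pos: "0 < n * (N * N)" using \<open>0 < n\<close> N_pos by simp
  \<comment> \<open>\<open>M\<close> in the shape of the bound of \<open>sum_digit_less\<close>, for
    digits up to \<open>n * (N * N)\<close>.\<close>
  have M: "M = 4 * n * N * (n * (N * N))" by (simp add: M_def)
  note less = sum_digit_less[OF A \<open>0 < n\<close> _ pos, folded M]
  have le: "n * N \<le> n * (N * N)" "n \<le> n * (N * N)" "4 * 1 \<le> 4 * (n * N)"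
    using \<open>0 < n\<close> N_pos by auto
  have M_ge: "4 * n * N \<le> M"
    using pos by (simp add: M)
  have "1 < 4 * n * N"
    using le(3) unfolding mult.assoc by linarith
  then have "1 * (n * (N * N)) < 4 * n * N * (n * (N * N))"
    using pos by (rule mult_strict_right_mono)
  then have "n * (N * N) < M"
    by (simp add: M)
  then have lt: "n * N < M" "n < M" using le(1,2) by linarith+
  \<comment> \<open>For the value digit the same count is multiplied by \<open>t\<close>, and
    \<open>4 * n * N \<le> M\<close> gives room below \<open>B\<close>.\<close>
  have tB: "4 * n * N * t \<le> B" "t < B"
    using M_ge \<open>1 < 4 * n * N\<close> \<open>0 < t\<close> by (auto simp: B_def mult.commute[of t])
  let ?S = "\<lambda>f :: bool \<times> nat \<times> nat \<Rightarrow> nat. \<Sum>x\<in>#A. f x"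
  have less': "?S digit0 < B" "?S digit1 < M" "?S digit2 < M" "?S digit3 < M"
  proof -
    have "?S digit0 < 4 * n * N * t"
      using digit_bounds(1) \<open>0 < n\<close> by (intro sum_digit_less A \<open>0 < t\<close>)
    with tB(1) show "?S digit0 < B" by linarith
    show "?S digit1 < M" "?S digit2 < M" "?S digit3 < M"
      using digit_bounds(2-4) \<open>0 < n\<close> by (intro less; blast)+
  qed
  from digits_unique[OF goal[unfolded sum_val goal_def] less'(1) tB(2)]
  have 0: "?S digit0 = t"
    and 1: "?S digit1 + M * (?S digit2 + M * (?S digit3 + M * ?S digit4))
      = n * N + M * (n * (N * N) + M * (n + M))" by auto
  from digits_unique[OF 1 less'(2) lt(1)]
  have 2: "?S digit1 = n * N"
    and 3: "?S digit2 + M * (?S digit3 + M * ?S digit4) = n * (N * N) + M * (n + M)" by auto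
  from digits_unique[OF 3 less'(3) \<open>n * (N * N) < M\<close>]
  have 4: "?S digit2 = n * (N * N)" and 5: "?S digit3 + M * ?S digit4 = n + M * 1" by auto
  from digits_unique[OF 5 less'(4) lt(2)] 0 2 4
  show "?S digit0 = t" "?S digit1 = n * N" "?S digit2 = n * (N * N)" "?S digit3 = n"
    "?S digit4 = 1" by auto
qed

section \<open>Equivalence with the given instances\<close>

lemma composition_sound:
  assumes Y: "Y \<subseteq># mset elems" "sum_mset Y = goal" and "0 < n" "0 < t"
  shows "\<exists>k<N. \<exists>Z. Z \<subseteq># mset (xs k) \<and> sum_mset Z = tg k"
proof -
  from Y obtain A where A: "A \<subseteq># mset labelled" and val: "(\<Sum>x\<in>#A. val x) = goal"
    using subset_image_mset[of Y val "mset labelled"] by (auto simp: elems_eq)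
  note sums = digits_of_sum[OF A \<open>0 < n\<close> \<open>0 < t\<close> val]
  have in_labelled: "x \<in> set labelled" if "x \<in># A" for x
    using mset_subset_eqD[OF A that] by simp
  define S where "S = filter_mset fst A"
  define R where "R = filter_mset (\<lambda>x. \<not> fst x) A"
  have split: "A = S + R" by (simp add: S_def R_def)
  \<comment> \<open>Digits 4 and 3 count selectors and tagged elements, so there is one selector and
    there are \<open>n\<close> others.\<close>
  have "size S = (\<Sum>x\<in>#A. digit4 x)" "size R = (\<Sum>x\<in>#A. digit3 x)"
    unfolding S_def R_def by (induction A) auto
  then have "size S = 1" and size_R: "size R = n"
    using sums by auto
  then obtain s where s: "S = {#s#}" by (blast dest: size_1_singleton_mset)
  then have "s \<in># filter_mset fst A" by (simp add: S_def)
  then have "s \<in># A" "fst s" by auto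
  then obtain k where k: "k < N" "s = (True, k, t - tg k)"
    using in_labelled by (metis fst_conv labelled_cases)
  have R_digits: "image_mset digit1 R = image_mset (\<lambda>x. fst (snd x)) R"
    "image_mset digit2 R = image_mset (\<lambda>x. fst (snd x) * fst (snd x)) R"
    by (auto simp: R_def intro!: image_mset_cong)
  have "n * (N - k) + (\<Sum>x\<in>#R. fst (snd x)) = n * N"
    using sums(2) unfolding split s k by (simp add: R_digits)
  moreover have "n * N = n * (N - k) + n * k"
    using k(1) by (simp flip: add_mult_distrib2)
  ultimately have 1: "(\<Sum>x\<in>#R. fst (snd x)) = size R * k"
    using size_R by simp
  have "n * (N * N - k * k) + (\<Sum>x\<in>#R. fst (snd x) * fst (snd x)) = n * (N * N)"
    using sums(3) unfolding split s k by (simp add: R_digits)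
  moreover have "n * (N * N) = n * (N * N - k * k) + n * (k * k)"
    using k(1) by (simp add: mult_le_mono flip: add_mult_distrib2)
  ultimately have 2: "(\<Sum>x\<in>#R. fst (snd x) * fst (snd x)) = size R * (k * k)"
    using size_R by simp
  \<comment> \<open>The instance indices in \<open>R\<close> have mean \<open>k\<close> and mean
    square \<open>k * k\<close>, hence all equal \<open>k\<close> and the filter removes nothing
    more.\<close>
  have "R = filter_mset (\<lambda>x. \<not> fst x \<and> fst (snd x) = k) A"
    using mean_on_parabola[OF 1 2] unfolding R_def by (intro filter_mset_cong) auto
  also have "\<dots> \<subseteq># filter_mset (\<lambda>x. \<not> fst x \<and> fst (snd x) = k) (mset labelled)"
    using A by (rule multiset_filter_mono)
  also have "\<dots> = mset (items k)"
    unfolding mset_filter[symmetric] filter_labelled[OF k(1)] ..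
  finally have "R \<subseteq># mset (items k)" .
  define V where "V = image_mset digit0 R"
  have "V \<subseteq># mset (map digit0 (items k))"
    using image_mset_subseteq_mono[OF \<open>R \<subseteq># mset (items k)\<close>] by (simp add: V_def)
  \<comment> \<open>Zeros may come from dummies or from replaced large elements and need not belong
    to \<open>xs k\<close>. Dropping all of them leaves the sum unchanged.\<close>
  then have "filter_mset ((<) 0) V \<subseteq># mset (filter ((<) 0) (map digit0 (items k)))"
    by (metis mset_filter multiset_filter_mono)
  also have "filter ((<) 0) (map digit0 (items k)) = filter (\<lambda>x. 0 < x \<and> x \<le> t) (xs k)"
  proof -
    have "filter ((<) 0) (map digit0 (items k))
        = filter ((<) 0) (map (\<lambda>x. if t < x then 0 else x) (xs k))"
      by (simp add: items_def o_def)
    also have "\<dots> = filter (\<lambda>x. 0 < x \<and> x \<le> t) ys" if "ys = xs k" for ys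
      unfolding that[symmetric] by (induction ys) auto
    finally show ?thesis by simp
  qed
  also have "mset \<dots> \<subseteq># mset (xs k)"
    by simp
  finally have "filter_mset ((<) 0) V \<subseteq># mset (xs k)" .
  moreover have "sum_mset (filter_mset ((<) 0) V) = tg k"
  proof -
    have "sum_mset (filter_mset ((<) 0) V) = sum_mset V"
      by (induction V) auto
    moreover have "t - tg k + sum_mset V = t"
      using sums(1) unfolding split s k by (simp add: V_def)
    ultimately show ?thesis
      using tg_le[OF k(1)] by simp
  qed
  ultimately show ?thesis
    using k(1) by blast
qed

lemma composition_complete:
  assumes k: "k < N" and Z: "Z \<subseteq># mset (xs k)" "sum_mset Z = tg k"
  shows "\<exists>Y. Y \<subseteq># mset elems \<and> sum_mset Y = goal"
proof -
  \<comment> \<open>The dummies fill up the solution \<open>Z\<close> to exactly \<open>n\<close>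
    tagged elements.\<close>
  define Y where "Y = {#selector k#} + replicate_mset (n - size Z) (tag k)
    + image_mset (\<lambda>x. tag k + x) Z"
  have size_Z: "size Z \<le> n"
    using size_mset_mono[OF Z(1)] length_le[OF k] by simp
  \<comment> \<open>A member of \<open>Z\<close> is at most the sum \<open>tg k\<close>, so no
    member of \<open>Z\<close> was replaced by a dummy.\<close>
  have "x \<le> t" if "x \<in># Z" for x
  proof -
    from that obtain Z' where "Z = add_mset x Z'" by (rule mset_add)
    then show ?thesis using Z(2) tg_le[OF k] by simp
  qed
  then have "image_mset (\<lambda>x. tag k + x) Z
      = image_mset (\<lambda>x. if t < x then tag k else tag k + x) Z"
    by (intro image_mset_cong) (auto simp: not_less)
  also have "\<dots> \<subseteq># image_mset (\<lambda>x. if t < x then tag k else tag k + x) (mset (xs k))"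
    using Z(1) by (rule image_mset_subseteq_mono)
  finally have "Y \<subseteq># {#selector k#} + replicate_mset n (tag k)
      + image_mset (\<lambda>x. if t < x then tag k else tag k + x) (mset (xs k))"
    unfolding Y_def by (intro subset_mset.add_mono) (auto simp: replicate_mset_msubseteq_iff)
  also have "\<dots> = mset (block k)"
    by (simp add: block_def)
  also have "mset (block k) \<subseteq># mset elems"
    by (simp add: elems_def upt_split[OF k])
  finally have "Y \<subseteq># mset elems" .
  moreover have "sum_mset Y = goal"
  proof -
    have "sum_mset Y = selector k + (n - size Z) * tag k + (size Z * tag k + sum_mset Z)"
      by (simp add: Y_def sum_mset.distrib)
    also have "\<dots> = selector k + n * tag k + tg k"
      using size_Z Z(2) by (simp flip: add_mult_distrib)
    also have "\<dots> = (t - tg k + tg k) + B * ((n * (N - k) + n * k)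
        + M * ((n * (N * N - k * k) + n * (k * k)) + M * (n + M)))"
      by (simp add: selector_def tag_def algebra_simps)
    also have "\<dots> = goal"
      using tg_le[OF k] k by (simp add: goal_def mult_le_mono flip: add_mult_distrib2)
    finally show ?thesis .
  qed
  ultimately show ?thesis by blast
qed

end

section \<open>The program\<close>

abbreviation reg :: "nat \<Rightarrow> expr" where "reg k \<equiv> Mem (Const k)"
text \<open>In the encoding the target of an instance is followed by its length and then by its
  elements, which explains the offsets 1 and 2 throughout.\<close>

abbreviation len_at :: "nat \<Rightarrow> expr" where "len_at k \<equiv> In (Add (reg k) (Const 1))"

text \<open>Registers: 0 for \<open>t\<close>, 1 for \<open>n\<close>, 2 for the flag raised by a target 0, 3 for the position
  in the input, 4 for the instance, 5 for the number of dummy elements written, 6 for the end of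
  the instance, 7 for the tag of the instance, 8 and 9 for \<open>M\<close> and \<open>B\<close>.\<close>

definition scan_body :: prog where
  "scan_body =
     Seq (IfLess (reg 0) (In (reg 3)) (Store (Const 0) (In (reg 3))) Skip)
    (Seq (IfLess (reg 1) (len_at 3) (Store (Const 1) (len_at 3)) Skip)
    (Seq (IfLess (In (reg 3)) (Const 1) (Store (Const 2) (Const 1)) Skip)
    (Seq (Store (Const 3) (Add (reg 3) (Add (Const 2) (len_at 3))))
         (Store (Const 4) (Add (reg 4) (Const 1))))))"

definition scan :: prog where
  "scan = Seq (Store (Const 3) (Const 1)) (WhileLess (reg 4) (In (Const 0)) scan_body)"

text \<open>The number of output elements must be known before they are written. After the scan,
  register 3 exceeds the total number of given elements by \<open>2 * N + 1\<close>; adding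
  \<open>n * N\<close> for the dummies and subtracting \<open>N + 1\<close> leaves also the
  \<open>N\<close> selectors.\<close>

definition header :: prog where
  "header =
     Seq (Store (Const 8)
           (Mul (Mul (Mul (Mul (Mul (Const 4) (reg 1)) (reg 1)) (reg 4)) (reg 4)) (reg 4)))
    (Seq (Store (Const 9) (Mul (reg 0) (reg 8)))
    (Seq (Write (Add (reg 0) (Mul (reg 9) (Add (Mul (reg 1) (reg 4)) (Mul (reg 8)
           (Add (Mul (reg 1) (Mul (reg 4) (reg 4))) (Mul (reg 8) (Add (reg 1) (reg 8)))))))))
    (Seq (Write (Sub (Add (reg 3) (Mul (reg 1) (reg 4))) (Add (reg 4) (Const 1))))
    (Seq (Store (Const 3) (Const 1))
         (Store (Const 4) (Const 0))))))"

definition block_head :: prog where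
  "block_head =
     Seq (Store (Const 7)
           (Mul (reg 9) (Add (reg 4) (Mul (reg 8) (Add (Mul (reg 4) (reg 4)) (reg 8))))))
         (Write (Add (Sub (reg 0) (In (reg 3)))
           (Mul (reg 9) (Add (Mul (reg 1) (Sub (In (Const 0)) (reg 4)))
             (Mul (reg 8) (Add
               (Mul (reg 1) (Sub (Mul (In (Const 0)) (In (Const 0))) (Mul (reg 4) (reg 4))))
               (Mul (reg 8) (reg 8))))))))"

definition dummy_body :: prog where
  "dummy_body = Seq (Write (reg 7)) (Store (Const 5) (Add (reg 5) (Const 1)))"

definition block_mid :: prog where
  "block_mid =
     Seq (Store (Const 6) (Add (reg 3) (Add (Const 2) (len_at 3))))
         (Store (Const 3) (Add (reg 3) (Const 2)))"

text \<open>As second operand of the comparison, an element is not charged beyond the length of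
  \<open>t\<close>; it is read in full only if it is at most \<open>t\<close>.\<close>

definition item_body :: prog where
  "item_body =
     Seq (IfLess (reg 0) (In (reg 3)) (Write (reg 7)) (Write (Add (reg 7) (In (reg 3)))))
         (Store (Const 3) (Add (reg 3) (Const 1)))"

text \<open>Clearing the auxiliary registers gives all rounds a start state of the same
  form.\<close>

definition block_end :: prog where
  "block_end =
     Seq (Store (Const 5) (Const 0))
    (Seq (Store (Const 6) (Const 0))
    (Seq (Store (Const 7) (Const 0))
         (Store (Const 4) (Add (reg 4) (Const 1)))))"

definition block_body :: prog where
  "block_body =
     Seq block_head
    (Seq (WhileLess (reg 5) (reg 1) dummy_body)
    (Seq block_mid
    (Seq (WhileLess (reg 3) (reg 6) item_body)
         block_end)))"

text \<open>A target 0 leads to the solvable instance without elements and with target 0. Otherwise,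
  \<open>n = 0\<close> leads to the unsolvable one without elements and with target
  \<open>t\<close>, which is then positive.\<close>

definition or_prog :: prog where
  "or_prog = Seq scan
     (IfLess (Const 0) (reg 2) (Seq (Write (Const 0)) (Write (Const 0)))
     (IfLess (reg 1) (Const 1) (Seq (Write (reg 0)) (Write (Const 0)))
     (Seq header (WhileLess (reg 4) (In (Const 0)) block_body))))"

lemma psize_le:
  "psize scan_body \<le> 1000" "psize header \<le> 3000" "psize block_head \<le> 3000"
  "psize dummy_body \<le> 1000" "psize block_mid \<le> 1000" "psize item_body \<le> 1000"
  "psize block_end \<le> 1000" "psize (Store (Const 3) (Const 1)) \<le> 9"
  "psize (Seq (Write (reg 0)) (Write (Const 0))) \<le> 20"
  "psize (Seq (Write (Const 0)) (Write (Const 0))) \<le> 20"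
  by code_simp+

text \<open>Folds the loop tests into the bound for the body: \<open>Suc k \<le> 2 * l\<close> tests
  of cost at most \<open>64 * d\<close> amount to 128 per round. The positive \<open>l\<close> also
  covers a loop that runs zero rounds.\<close>

lemma loop_cost_le:
  fixes d :: nat
  assumes "k \<le> l" "0 < l" "e \<le> 8" "c + 128 \<le> c'"
  shows "k * (c * d) + Suc k * (e\<^sup>2 * d) \<le> l * (c' * d)"
proof -
  have "e\<^sup>2 \<le> 8\<^sup>2" using assms(3) by (rule power_mono) simp
  then have "k * (c * d) + Suc k * (e\<^sup>2 * d) \<le> l * (c * d) + (2 * l) * (64 * d)"
    using assms(1,2) by (intro add_mono mult_le_mono) auto
  also have "\<dots> = l * ((c + 128) * d)"
    by (simp add: algebra_simps)
  also have "\<dots> \<le> l * (c' * d)"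
    using assms(4) by simp
  finally show ?thesis .
qed

lemma loop_free_parts:
  "loop_free scan_body" "loop_free header" "loop_free block_head"
  "loop_free dummy_body" "loop_free block_mid" "loop_free item_body" "loop_free block_end"
  by code_simp+

context or_composition
begin

section \<open>Input layout and register lengths\<close>

definition pos :: "nat \<Rightarrow> nat" where
  "pos i = 1 + (\<Sum>k<i. 2 + length (xs k))"

definition input :: "nat list" where
  "input = N # concat (map (\<lambda>i. tg i # length (xs i) # xs i) [0..<N])"

text \<open>A single quantity above \<open>N\<close>, \<open>n\<close> and \<open>blen t\<close>,
  chosen as a product so that the time bound takes the form of the theorem.\<close>

definition \<beta> :: nat where
  "\<beta> = max 1 n * N * blen t"

definition width :: nat where
  "width = 40 * \<beta>"

lemma pos_Suc: "pos (Suc i) = pos i + 2 + length (xs i)"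
  by (simp add: pos_def)

lemma input_split:
  assumes "i < N"
  obtains us vs where "length us = pos i" "input = us @ tg i # length (xs i) # xs i @ vs"
proof -
  let ?f = "\<lambda>i. tg i # length (xs i) # xs i"
  have "length (N # concat (map ?f [0..<i])) = pos i"
    unfolding pos_def by (induction i) auto
  moreover have "input = (N # concat (map ?f [0..<i])) @ tg i # length (xs i) # xs i
      @ concat (map ?f [Suc i..<N])"
    unfolding input_def upt_split[OF assms] by simp
  ultimately show thesis by (rule that)
qed

lemma eval_input:
  assumes "i < N"
  shows "pos i < length input" "input ! pos i = tg i"
    "Suc (pos i) < length input" "input ! Suc (pos i) = length (xs i)"
    "j < length (xs i) \<Longrightarrow> pos i + 2 + j < length input"
    "j < length (xs i) \<Longrightarrow> input ! (pos i + 2 + j) = xs i ! j"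
proof -
  obtain us vs where *: "length us = pos i" "input = us @ tg i # length (xs i) # xs i @ vs"
    using assms by (rule input_split)
  show "pos i < length input" "input ! pos i = tg i"
    "Suc (pos i) < length input" "input ! Suc (pos i) = length (xs i)"
    using * by (auto simp: nth_append)
  show "pos i + 2 + j < length input" "input ! (pos i + 2 + j) = xs i ! j"
    if "j < length (xs i)"
    using * that by (auto simp: nth_append)
qed

lemma input_0 [simp]: "input \<noteq> []" "input ! 0 = N"
  by (simp_all add: input_def)

lemma pos_mono: "i \<le> j \<Longrightarrow> pos i \<le> pos j"
  unfolding pos_def by (intro add_left_mono sum_mono2) auto

lemma pos_N_le: "pos N \<le> 1 + N * (2 + n)"
proof -
  have "(\<Sum>k<N. 2 + length (xs k)) \<le> (\<Sum>k<N. 2 + n)"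
    using length_le by (intro sum_mono) auto
  then show ?thesis by (simp add: pos_def)
qed

lemma beta_bounds: "1 \<le> \<beta>" "N \<le> \<beta>" "n \<le> \<beta>" "blen t \<le> \<beta>"
proof -
  have "1 \<le> N" "1 \<le> blen t" using N_pos blen_pos[of t] by auto
  then have "1 \<le> N * blen t" "1 \<le> max 1 n * N" by (auto simp: Suc_le_eq)
  show "1 \<le> \<beta>" "N \<le> \<beta>" "n \<le> \<beta>" "blen t \<le> \<beta>"
    using \<open>1 \<le> N\<close> \<open>1 \<le> blen t\<close> \<open>1 \<le> N * blen t\<close> \<open>1 \<le> max 1 n * N\<close>
      mult_le_mono[of N "max 1 n * N" 1 "blen t"] mult_le_mono[of n "max 1 n" 1 "N * blen t"]
      mult_le_mono[of 1 "max 1 n * N" "blen t" "blen t"]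
    by (simp_all add: \<beta>_def mult.assoc)
qed

lemma width_pos: "0 < width"
  using beta_bounds(1) by (simp add: width_def)

text \<open>Lengths add up along the defining terms, counted in multiples of \<open>\<beta>\<close>:
  4 for a small constant, 10 for a position, 9 for \<open>M\<close>, 10 for \<open>B\<close>, and 31
  for a tag, rounded up to 40.\<close>

lemma blen_le_width:
  "k < 16 \<Longrightarrow> blen k \<le> width"
  "k \<le> t \<Longrightarrow> blen k \<le> width" "k \<le> n \<Longrightarrow> blen k \<le> width" "k \<le> N \<Longrightarrow> blen k \<le> width"
  "k \<le> pos N \<Longrightarrow> blen k \<le> width"
  "blen M \<le> width" "blen B \<le> width" "i < N \<Longrightarrow> blen (tag i) \<le> width"
proof -
  note b = beta_bounds
  have small: "k \<le> \<beta> \<Longrightarrow> blen k \<le> \<beta>" for k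
    using b(1) blen_le_self[of k] by (cases "k = 0") (auto simp: blen_def floorlog_def)
  have const: "k < 16 \<Longrightarrow> blen k \<le> 4 * \<beta>" for k
    using b(1) blen_le_iff[of 4 k] by simp
  have t: "k \<le> t \<Longrightarrow> blen k \<le> \<beta>" for k
    using b(4) blen_mono[of k t] by simp
  have N: "k \<le> N \<Longrightarrow> blen k \<le> \<beta>" and n: "k \<le> n \<Longrightarrow> blen k \<le> \<beta>" for k
    using b(2,3) small[of k] by auto
  have pos: "blen k \<le> 10 * \<beta>" if "k \<le> pos N" for k
  proof -
    have "k \<le> 1 + N * (2 + n)"
      using pos_N_le that by simp
    then have "blen k \<le> blen (1 + N * (2 + n))"
      by (rule blen_mono)
    also have "\<dots> \<le> blen 1 + (blen N + (blen 2 + blen n))"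
      by (intro order_trans[OF blen_add] order_trans[OF blen_mult] add_mono order_refl)
    also have "\<dots> \<le> 10 * \<beta>"
      using N[of N] n[of n] const[of 1] const[of 2] by simp
    finally show ?thesis .
  qed
  have "blen M \<le> blen 4 + blen n + blen n + blen N + blen N + blen N"
    unfolding M_def by (intro order_trans[OF blen_mult] add_mono order_refl)
  then have M: "blen M \<le> 9 * \<beta>"
    using N[of N] n[of n] const[of 4] by simp
  have "blen B \<le> blen t + blen M"
    unfolding B_def by (rule blen_mult)
  then have B: "blen B \<le> 10 * \<beta>"
    using M t[of t] by simp
  have tag: "blen (tag i) \<le> 40 * \<beta>" if "i < N"
  proof -
    have "blen (tag i) \<le> blen B + (blen i + (blen M + ((blen i + blen i) + blen M)))"
      unfolding tag_def
      by (intro order_trans[OF blen_add] order_trans[OF blen_mult] add_mono order_refl)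
    then show ?thesis
      using M B N[of i] that by simp
  qed
  have weaken: "x \<le> 4 * \<beta> \<Longrightarrow> x \<le> width" "x \<le> \<beta> \<Longrightarrow> x \<le> width"
    "x \<le> 10 * \<beta> \<Longrightarrow> x \<le> width" "x \<le> 9 * \<beta> \<Longrightarrow> x \<le> width"
    "x \<le> 40 * \<beta> \<Longrightarrow> x \<le> width" for x
    by (simp_all add: width_def)
  show "k < 16 \<Longrightarrow> blen k \<le> width" by (rule weaken(1)[OF const])
  show "k \<le> t \<Longrightarrow> blen k \<le> width" by (rule weaken(2)[OF t])
  show "k \<le> n \<Longrightarrow> blen k \<le> width" by (rule weaken(2)[OF n])
  show "k \<le> N \<Longrightarrow> blen k \<le> width" by (rule weaken(2)[OF N])
  show "k \<le> pos N \<Longrightarrow> blen k \<le> width" by (rule weaken(3)[OF pos])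
  show "blen M \<le> width" by (rule weaken(4)[OF M])
  show "blen B \<le> width" by (rule weaken(3)[OF B])
  show "i < N \<Longrightarrow> blen (tag i) \<le> width" by (rule weaken(5)[OF tag])
qed

section \<open>First pass: maxima and zero targets\<close>

definition flag :: "nat \<Rightarrow> nat" where
  "flag i = (if \<exists>k<i. tg k = 0 then 1 else 0)"

text \<open>The loop invariant of the scan after \<open>i\<close> instances.\<close>

definition scan_state :: "nat \<Rightarrow> nat \<Rightarrow> nat" where
  "scan_state i = mem [pmax tg i, pmax (\<lambda>k. length (xs k)) i, flag i, pos i, i, 0, 0, 0, 0, 0]"

lemmas exec_simps = mem_upd list_update_numeral
  mem_def[of _ "Suc _"] mem_def[of _ "numeral _"] mem_def[of _ 0]

lemma scan_step:
  assumes "i < N"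
  shows "sem input scan_body (scan_state i, out) = (scan_state (Suc i), out)"
    and "short_prog input width scan_body (scan_state i, out)"
proof -
  note e = eval_input[OF assms]
  have flag: "flag (Suc i) = (if tg i = 0 then 1 else flag i)"
    by (auto simp: flag_def less_Suc_eq)
  show sem: "sem input scan_body (scan_state i, out) = (scan_state (Suc i), out)"
    by (simp add: scan_body_def scan_state_def exec_simps e flag pos_Suc)
  have "pmax tg i \<le> t" "pmax (\<lambda>k. length (xs k)) i \<le> n"
    using assms by (auto simp: t_def n_def intro!: pmax_mono)
  have "pos (Suc i) \<le> pos N" using assms by (intro pos_mono) simp
  then have p: "pos i \<le> pos N" by (simp add: pos_Suc)
  show "short_prog input width scan_body (scan_state i, out)"
    using assms tg_le[OF assms] length_le[OF assms] \<open>pmax tg i \<le> t\<close>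
      \<open>pmax (\<lambda>k. length (xs k)) i \<le> n\<close>
    by (simp add: scan_body_def scan_state_def exec_simps e flag pos_Suc p blen_le_width)
qed


text \<open>The invariant of the second pass. Register 2 is 0 since this pass is reached only if the
  flag is not raised.\<close>

definition block_state :: "nat \<Rightarrow> nat \<Rightarrow> nat" where
  "block_state i = mem [t, n, 0, pos i, i, 0, 0, 0, M, B]"

lemma runs_sem:
  assumes "loop_free P" "short_prog input width P s" "sem input P s = s'" "psize P \<le> c"
  shows "runs input P s (c * width) s'"
proof -
  have "runs input P s (psize P * width) s'"
    using runs_loop_free[OF assms(1,2) width_pos] assms(3) by simp
  then show ?thesis
    by (rule runs_mono) (use assms(4) in simp)
qed

lemma runs_scan:
  "runs input scan (\<lambda>_. 0, []) (N * (3000 * width)) (scan_state N, [])"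
proof -
  \<comment> \<open>The empty memory as ten registers, so that register updates become list
    updates.\<close>
  have 0: "(\<lambda>_. 0) = mem [0, 0, 0, 0, 0, 0, 0, 0, 0, 0]"
    by (auto simp: mem_def fun_eq_iff nth_Cons split: nat.splits)
  have "runs input (WhileLess (reg 4) (In (Const 0)) scan_body) (scan_state 0, [])
      (N * (2000 * width)) (scan_state N, [])"
  proof (rule runs_While[where k = N and d = width and out = "\<lambda>_. []"])
    fix i assume "i < N"
    show "runs input scan_body (scan_state i, []) (1000 * width) (scan_state (Suc i), [])"
      by (intro runs_sem scan_step \<open>i < N\<close> psize_le loop_free_parts)
  next
    show "N * (1000 * width) + Suc N * ((esize (reg 4) + esize (In (Const 0)))\<^sup>2 * width)
        \<le> N * (2000 * width)"
      using N_pos by (intro loop_cost_le) auto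
  qed (auto simp: scan_state_def exec_simps blen_le_width)
  moreover have "runs input (Store (Const 3) (Const 1)) (\<lambda>_. 0, []) (9 * width) (scan_state 0, [])"
    unfolding 0 by (rule runs_sem[OF _ _ _ psize_le(8)])
      (simp_all add: scan_state_def exec_simps blen_le_width flag_def pos_def)
  ultimately show ?thesis
    unfolding scan_def using N_pos by (auto elim!: runs_Seq)
qed

section \<open>Second pass: writing the blocks\<close>

lemma runs_block:
  assumes "i < N"
  shows "runs input block_body (block_state i, out) (max 1 n * (9000 * width))
    (block_state (Suc i), out @ block i)"
proof -
  note e = eval_input[OF assms]
  \<comment> \<open>Within a block only the position, the dummy counter and the end of the instance
    change once the tag is stored.\<close>
  let ?m = "\<lambda>p j q. mem [t, n, 0, p, i, j, q, tag i, M, B]"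
  have p: "pos i \<le> pos N" "pos i + 2 + length (xs i) \<le> pos N"
    using assms pos_mono[of i N] pos_mono[of "Suc i" N] by (auto simp: pos_Suc)
  have head: "runs input block_head (block_state i, out) (3000 * width)
      (?m (pos i) 0 0, out @ [selector i])"
    using assms tg_le[OF assms] p
    by (intro runs_sem psize_le loop_free_parts) (simp_all add: block_head_def block_state_def exec_simps e
        blen_le_width tag_def[symmetric] selector_def)
  have dummies: "runs input (WhileLess (reg 5) (reg 1) dummy_body)
      (?m (pos i) 0 0, out @ [selector i]) (max 1 n * (2000 * width))
      (?m (pos i) n 0, out @ [selector i] @ replicate n (tag i))"
  proof -
    \<comment> \<open>The start output is written with \<open>replicate 0\<close> to match round 0
      of the invariant; \<open>take 0\<close> does the same for the items.\<close>
    have "runs input (WhileLess (reg 5) (reg 1) dummy_body)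
      (?m (pos i) 0 0, out @ [selector i] @ replicate 0 (tag i)) (max 1 n * (2000 * width))
      (?m (pos i) n 0, out @ [selector i] @ replicate n (tag i))"
    proof (rule runs_While[where k = n and d = width and c = "1000 * width"
          and M = "\<lambda>j. ?m (pos i) j 0" and out = "\<lambda>j. out @ [selector i] @ replicate j (tag i)"])
      fix j assume "j < n"
      then show "runs input dummy_body (?m (pos i) j 0, out @ [selector i] @ replicate j (tag i))
          (1000 * width) (?m (pos i) (Suc j) 0, out @ [selector i] @ replicate (Suc j) (tag i))"
        using assms
        by (intro runs_sem psize_le loop_free_parts) (simp_all add: dummy_body_def exec_simps
            blen_le_width replicate_append_same)
    next
      \<comment> \<open>The factor \<open>max 1 n\<close> also pays for the failing test if
        \<open>n = 0\<close>.\<close>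
      show "n * (1000 * width) + Suc n * ((esize (reg 5) + esize (reg 1))\<^sup>2 * width)
          \<le> max 1 n * (2000 * width)"
        by (intro loop_cost_le) auto
    qed (use assms in \<open>auto simp: exec_simps blen_le_width\<close>)
    then show ?thesis by simp
  qed
  have mid: "runs input block_mid (?m (pos i) n 0, out') (1000 * width)
      (?m (pos i + 2) n (pos (Suc i)), out')" for out'
    using assms length_le[OF assms] p
    by (intro runs_sem psize_le loop_free_parts) (simp_all add: block_mid_def exec_simps e
        blen_le_width pos_Suc)
  let ?g = "\<lambda>x. if t < x then tag i else tag i + x"
  have items: "runs input (WhileLess (reg 3) (reg 6) item_body)
      (?m (pos i + 2) n (pos (Suc i)), out') (max 1 n * (2000 * width))
      (?m (pos (Suc i)) n (pos (Suc i)), out' @ map ?g (xs i))" for out'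
  proof -
    have "runs input (WhileLess (reg 3) (reg 6) item_body)
      (?m (pos i + 2 + 0) n (pos (Suc i)), out' @ map ?g (take 0 (xs i))) (max 1 n * (2000 * width))
      (?m (pos i + 2 + length (xs i)) n (pos (Suc i)), out' @ map ?g (take (length (xs i)) (xs i)))"
    proof (rule runs_While[where k = "length (xs i)" and d = width and c = "1000 * width"
          and M = "\<lambda>j. ?m (pos i + 2 + j) n (pos (Suc i))"
          and out = "\<lambda>j. out' @ map ?g (take j (xs i))"])
      fix j assume "j < length (xs i)"
      then show "runs input item_body
          (?m (pos i + 2 + j) n (pos (Suc i)), out' @ map ?g (take j (xs i))) (1000 * width)
          (?m (pos i + 2 + Suc j) n (pos (Suc i)), out' @ map ?g (take (Suc j) (xs i)))"
        using assms p eval_input(5,6)[OF assms]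
        by (intro runs_sem psize_le loop_free_parts) (simp_all add: item_body_def exec_simps
            blen_le_width take_Suc_conv_app_nth)
    next
      show "length (xs i) * (1000 * width) + Suc (length (xs i)) *
          ((esize (reg 3) + esize (reg 6))\<^sup>2 * width) \<le> max 1 n * (2000 * width)"
        using length_le[OF assms] by (intro loop_cost_le) auto
    qed (use p in \<open>auto simp: exec_simps blen_le_width pos_Suc\<close>)
    then show ?thesis by (simp add: pos_Suc)
  qed
  have fin: "runs input block_end (?m (pos (Suc i)) n (pos (Suc i)), out') (1000 * width)
      (block_state (Suc i), out')" for out'
    using assms
    by (intro runs_sem psize_le loop_free_parts) (simp_all add: block_end_def block_state_def
        exec_simps blen_le_width pos_Suc)
  \<comment> \<open>The straight parts cost 3000, 1000 and 1000 and the two loops 2000 times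
    \<open>max 1 n\<close> each, in units of \<open>width\<close>; together at most 9000 times
    \<open>max 1 n\<close>.\<close>
  have "runs input block_body (block_state i, out) (max 1 n * (9000 * width))
    (block_state (Suc i), (out @ [selector i] @ replicate n (tag i)) @ map ?g (xs i))"
    unfolding block_body_def
    by (rule runs_Seq[OF head runs_Seq[OF dummies runs_Seq[OF mid
              runs_Seq[OF items fin order_refl] order_refl] order_refl]])
      (simp add: max_def)
  then show ?thesis
    by (simp add: block_def)
qed


text \<open>Justifies the count computed by \<open>header\<close>, in additive form to avoid
  truncated subtraction.\<close>

lemma length_elems: "length elems + (N + 1) = pos N + n * N"
proof -
  have "length (concat (map block [0..<k])) + (k + 1) = pos k + n * k" for k
    by (induction k) (simp_all add: block_def pos_def)
  then show ?thesis by (simp add: elems_def)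
qed

lemma runs_compose:
  assumes "0 < n"
  shows "runs input (Seq header (WhileLess (reg 4) (In (Const 0)) block_body))
    (mem [t, n, 0, pos N, N, 0, 0, 0, 0, 0], []) (N * max 1 n * (13000 * width))
    (block_state N, goal # length elems # elems)"
proof -
  have "pos N + n * N - Suc N = length elems"
    using length_elems by simp
  then have header: "runs input header (mem [t, n, 0, pos N, N, 0, 0, 0, 0, 0], [])
      (3000 * width) (block_state 0, [goal, length elems])"
    by (intro runs_sem psize_le loop_free_parts) (simp_all add: header_def block_state_def
        exec_simps blen_le_width M_def[symmetric] B_def[symmetric] goal_def pos_def)
  have "runs input (WhileLess (reg 4) (In (Const 0)) block_body)
      (block_state 0, [goal, length elems] @ concat (map block [0..<0]))
      (N * (max 1 n * 10000 * width))
      (block_state N, [goal, length elems] @ concat (map block [0..<N]))"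
  proof (rule runs_While[where k = N and d = width and c = "max 1 n * 9000 * width"
        and out = "\<lambda>i. [goal, length elems] @ concat (map block [0..<i])"])
    fix i assume "i < N"
    then show "runs input block_body (block_state i, [goal, length elems] @ concat (map block [0..<i]))
        (max 1 n * 9000 * width)
        (block_state (Suc i), [goal, length elems] @ concat (map block [0..<Suc i]))"
      using runs_block[of i "[goal, length elems] @ concat (map block [0..<i])"]
      by (simp add: mult.assoc)
  next
    show "N * (max 1 n * 9000 * width) + Suc N * ((esize (reg 4) + esize (In (Const 0)))\<^sup>2 * width)
        \<le> N * (max 1 n * 10000 * width)"
      using N_pos by (intro loop_cost_le) auto
  qed (auto simp: block_state_def exec_simps blen_le_width)
  moreover have "3000 * width \<le> N * (max 1 n * 3000 * width)"
    using N_pos by simp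
  then have "3000 * width + N * (max 1 n * 10000 * width) \<le> N * max 1 n * (13000 * width)"
    by simp
  ultimately show ?thesis
    using header by (auto simp: elems_def intro: runs_Seq)
qed

section \<open>The complete run\<close>

lemma runs_or_prog:
  "\<exists>m. runs input or_prog (\<lambda>_. 0, []) (N * max 1 n * (20000 * width))
     (m, if \<exists>i<N. tg i = 0 then [0, 0] else if n = 0 then [t, 0]
         else goal # length elems # elems)"
proof -
  let ?v = "if \<exists>i<N. tg i = 0 then [0, 0] else if n = 0 then [t, 0]
    else goal # length elems # elems"
  let ?K = "N * max 1 n"
  have K: "1 \<le> ?K" using N_pos by (simp add: Suc_le_eq)
  then have le: "c \<le> c' \<Longrightarrow> c * width \<le> ?K * (c' * width)" for c c'
    using mult_le_mono[of 1 ?K "c * width" "c' * width"] by simp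
  have state: "scan_state N = mem [t, n, flag N, pos N, N, 0, 0, 0, 0, 0]"
    by (simp add: scan_state_def t_def n_def)
  have inner: "\<exists>m. runs input (IfLess (reg 1) (Const 1) (Seq (Write (reg 0)) (Write (Const 0)))
          (Seq header (WhileLess (reg 4) (In (Const 0)) block_body)))
      (mem [t, n, 0, pos N, N, 0, 0, 0, 0, 0], []) (?K * (14000 * width))
      (m, if n = 0 then [t, 0] else goal # length elems # elems)"
  proof -
    let ?m = "if n = 0 then mem [t, n, 0, pos N, N, 0, 0, 0, 0, 0] else block_state N"
    have "runs input (IfLess (reg 1) (Const 1) (Seq (Write (reg 0)) (Write (Const 0)))
          (Seq header (WhileLess (reg 4) (In (Const 0)) block_body)))
      (mem [t, n, 0, pos N, N, 0, 0, 0, 0, 0], []) (?K * (14000 * width))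
      (?m, if n = 0 then [t, 0] else goal # length elems # elems)"
    proof (rule runs_If[where d = width and k = "?K * (13000 * width)"])
      assume *: "eval_expr input (mem [t, n, 0, pos N, N, 0, 0, 0, 0, 0]) (reg 1)
        < eval_expr input (mem [t, n, 0, pos N, N, 0, 0, 0, 0, 0]) (Const 1)"
      have "runs input (Seq (Write (reg 0)) (Write (Const 0)))
        (mem [t, n, 0, pos N, N, 0, 0, 0, 0, 0], []) (20 * width)
        (mem [t, n, 0, pos N, N, 0, 0, 0, 0, 0], [t, 0])"
        by (rule runs_sem[OF _ _ _ psize_le(9)]) (simp_all add: exec_simps blen_le_width)
      with * show "runs input (Seq (Write (reg 0)) (Write (Const 0)))
          (mem [t, n, 0, pos N, N, 0, 0, 0, 0, 0], []) (?K * (13000 * width))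
          (?m, if n = 0 then [t, 0] else goal # length elems # elems)"
        using runs_mono le[of 20 13000] by (auto simp: exec_simps)
    next
      assume "\<not> eval_expr input (mem [t, n, 0, pos N, N, 0, 0, 0, 0, 0]) (reg 1)
        < eval_expr input (mem [t, n, 0, pos N, N, 0, 0, 0, 0, 0]) (Const 1)"
      then show "runs input (Seq header (WhileLess (reg 4) (In (Const 0)) block_body))
          (mem [t, n, 0, pos N, N, 0, 0, 0, 0, 0], []) (?K * (13000 * width))
          (?m, if n = 0 then [t, 0] else goal # length elems # elems)"
        using runs_compose by (auto simp: exec_simps)
    next
      have "(esize (reg 1) + esize (Const 1))\<^sup>2 * width \<le> ?K * (1000 * width)"
        by (rule le) (simp add: power2_eq_square)
      moreover have "?K * (14000 * width) = ?K * (1000 * width) + ?K * (13000 * width)"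
        by simp
      ultimately show "(esize (reg 1) + esize (Const 1))\<^sup>2 * width + ?K * (13000 * width)
          \<le> ?K * (14000 * width)"
        by (simp only: add_right_mono)
    qed (simp_all add: exec_simps blen_le_width)
    then show ?thesis by (rule exI[of _ ?m])
  qed
  then obtain m where inner: "runs input (IfLess (reg 1) (Const 1)
        (Seq (Write (reg 0)) (Write (Const 0)))
        (Seq header (WhileLess (reg 4) (In (Const 0)) block_body)))
      (mem [t, n, 0, pos N, N, 0, 0, 0, 0, 0], []) (?K * (14000 * width))
      (m, if n = 0 then [t, 0] else goal # length elems # elems)" ..
  define m' where "m' = (if \<exists>i<N. tg i = 0 then scan_state N else m)"
  have "runs input
      (IfLess (Const 0) (reg 2) (Seq (Write (Const 0)) (Write (Const 0)))
        (IfLess (reg 1) (Const 1) (Seq (Write (reg 0)) (Write (Const 0)))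
          (Seq header (WhileLess (reg 4) (In (Const 0)) block_body))))
      (scan_state N, []) (?K * (15000 * width)) (m', ?v)"
  proof (rule runs_If[where d = width and k = "?K * (14000 * width)"])
    assume *: "eval_expr input (scan_state N) (Const 0) < eval_expr input (scan_state N) (reg 2)"
    then have "\<exists>i<N. tg i = 0"
      by (auto simp: state exec_simps flag_def split: if_splits)
    moreover have "runs input (Seq (Write (Const 0)) (Write (Const 0)))
      (scan_state N, []) (20 * width) (scan_state N, [0, 0])"
      by (rule runs_sem[OF _ _ _ psize_le(10)]) (simp_all add: blen_le_width)
    ultimately show "runs input (Seq (Write (Const 0)) (Write (Const 0)))
        (scan_state N, []) (?K * (14000 * width)) (m', ?v)"
      using runs_mono le[of 20 14000] by (auto simp: m'_def)
  next
    assume "\<not> eval_expr input (scan_state N) (Const 0) < eval_expr input (scan_state N) (reg 2)"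
    then have *: "\<not> (\<exists>i<N. tg i = 0)"
      by (auto simp: state exec_simps flag_def split: if_splits)
    then have "flag N = 0" "m' = m"
      by (auto simp: flag_def m'_def)
    then show "runs input (IfLess (reg 1) (Const 1) (Seq (Write (reg 0)) (Write (Const 0)))
          (Seq header (WhileLess (reg 4) (In (Const 0)) block_body)))
        (scan_state N, []) (?K * (14000 * width)) (m', ?v)"
      using inner unfolding state \<open>flag N = 0\<close> \<open>m' = m\<close> if_not_P[OF *] by simp
  next
    have "(esize (Const 0) + esize (reg 2))\<^sup>2 * width \<le> ?K * (1000 * width)"
      by (rule le) (simp add: power2_eq_square)
    moreover have "?K * (15000 * width) = ?K * (1000 * width) + ?K * (14000 * width)"
      by simp
    ultimately show "(esize (Const 0) + esize (reg 2))\<^sup>2 * width + ?K * (14000 * width)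
        \<le> ?K * (15000 * width)"
      by (simp only: add_right_mono)
  qed (simp_all add: state exec_simps blen_le_width flag_def)
  moreover have "N * (3000 * width) + ?K * (15000 * width) \<le> ?K * (20000 * width)"
  proof -
    have "N * (3000 * width) \<le> ?K * (3000 * width)"
      by (intro mult_le_mono1) simp
    moreover have "?K * (20000 * width)
        = ?K * (3000 * width) + ?K * (15000 * width) + ?K * (2000 * width)"
      by simp
    ultimately show ?thesis by linarith
  qed
  ultimately have "runs input or_prog (\<lambda>_. 0, []) (?K * (20000 * width)) (m', ?v)"
    unfolding or_prog_def by (rule runs_Seq[OF runs_scan])
  then show ?thesis by (rule exI[of _ m'])
qed

section \<open>Correctness and size of the result\<close>

definition result :: subset_sum where
  "result = (if \<exists>i<N. tg i = 0 then ({#}, 0) else if n = 0 then ({#}, t) else (mset elems, goal))"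

text \<open>A target 0 is met by the empty choice. With \<open>n = 0\<close> and positive targets
  neither side is solvable; all else is soundness and completeness of the composition.\<close>

lemma yes_instance_result:
  "yes_instance result \<longleftrightarrow> (\<exists>i<N. yes_instance (mset (xs i), tg i))"
proof (cases "\<exists>i<N. tg i = 0")
  case True
  then obtain i where "i < N" "tg i = 0" by blast
  moreover from this have "yes_instance (mset (xs i), tg i)"
    unfolding yes_instance_def by (intro exI[of _ "{#}"]) simp
  ultimately have "\<exists>i<N. yes_instance (mset (xs i), tg i)" by blast
  with True show ?thesis by (simp add: result_def yes_instance_def)
next
  case False
  then have "0 < tg 0" using N_pos by auto
  then have t: "0 < t" using tg_le[of 0] N_pos by simp
  show ?thesis
  proof (cases "n = 0")
    case True
    then have "xs i = []" if "i < N" for i using length_le[OF that] by simp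
    then show ?thesis using True False t by (auto simp: result_def yes_instance_def)
  next
    case n: False
    then show ?thesis
      using False t composition_sound composition_complete
      by (auto simp: result_def yes_instance_def)
  qed
qed

text \<open>The special results have no elements, so the bound holds with \<open>n\<close> itself in
  place of \<open>max 1 n\<close>.\<close>

lemma size_result_le: "size (fst result) \<le> 3 * (n * N)"
proof (cases "n = 0")
  case False
  then have "N * (2 * n + 1) \<le> 3 * (n * N)" by simp
  with length_elems_le have "length elems \<le> 3 * (n * N)" by (rule order_trans)
  then show ?thesis by (simp add: result_def)
qed (simp add: result_def)

text \<open>With \<open>K = max 1 n * N\<close>, \<open>M\<close> is at most
  \<open>4 * K ^ 3\<close>, so \<open>M ^ 4\<close> is at most \<open>256 * K ^ 12\<close>; then
  \<open>5 * 256 + 1\<close> is rounded up to 2000.\<close>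

lemma result_target_le: "snd result \<le> t * (2000 * (max 1 n * N) ^ 12)"
proof -
  let ?K = "max 1 n * N"
  have K: "1 \<le> ?K" using N_pos by (simp add: Suc_le_eq)
  have "M = 4 * (n * N) ^ 2 * N" by (simp add: M_def power2_eq_square)
  also have "\<dots> \<le> 4 * ?K ^ 2 * ?K"
    by (intro mult_le_mono power_mono) auto
  finally have "M \<le> 4 * ?K ^ 3"
    by (simp add: power2_eq_square power3_eq_cube mult.assoc)
  then have "M ^ 4 \<le> (4 * ?K ^ 3) ^ 4"
    by (rule power_mono) simp
  also have "\<dots> = 256 * ?K ^ 12"
    by (simp add: power_mult_distrib flip: power_mult)
  finally have *: "5 * M ^ 4 + 1 \<le> 2000 * ?K ^ 12"
    using one_le_power[OF K, of 12] by linarith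
  have "t * 1 \<le> t * (2000 * ?K ^ 12)"
    using one_le_power[OF K, of 12] by (intro mult_le_mono2) linarith
  moreover have "0 < n \<Longrightarrow> goal \<le> t * (2000 * ?K ^ 12)"
    using goal_le mult_le_mono2[OF *, of t] by (rule order_trans)
  ultimately show ?thesis by (auto simp: result_def)
qed

text \<open>The time is quadratic: 20000 times 40 from \<open>width\<close>, doubled by
  \<open>blen_le_log\<close>, gives the factor 1600000. The exponent is raised to 12 because the
  theorem has one exponent for time and target.\<close>

lemma time_le:
  "real (N * max 1 n * (20000 * width))
    \<le> 3200000 * (real (max 1 n) * real N * max 1 (log 2 (real t))) ^ 12"
proof -
  let ?S = "real (max 1 n) * real N * max 1 (log 2 (real t))"
  have "real 1 \<le> real (max 1 n * N)"
    using N_pos by (intro of_nat_mono) (simp add: Suc_le_eq)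
  then have K: "1 \<le> real (max 1 n) * real N"
    by simp
  then have S: "1 \<le> ?S" "real (max 1 n) * real N \<le> ?S"
    using mult_mono[OF K, of 1 "max 1 (log 2 (real t))"]
      mult_left_mono[of 1 "max 1 (log 2 (real t))" "real (max 1 n) * real N"] by auto
  have "real \<beta> = real (max 1 n) * real N * real (blen t)"
    by (simp add: \<beta>_def)
  also have "\<dots> \<le> real (max 1 n) * real N * (2 * max 1 (log 2 (real t)))"
    by (intro mult_left_mono blen_le_log) simp
  finally have "real \<beta> \<le> 2 * ?S" by simp
  have "real (N * max 1 n * (20000 * width)) = (real (max 1 n) * real N) * (800000 * real \<beta>)"
    by (simp add: width_def)
  also have "\<dots> \<le> ?S * (800000 * (2 * ?S))"
  proof (rule mult_mono[OF S(2)])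
    show "0 \<le> ?S" using S(1) by linarith
    show "800000 * real \<beta> \<le> 800000 * (2 * ?S)"
      using \<open>real \<beta> \<le> 2 * ?S\<close> by (rule mult_left_mono) simp
  qed simp
  also have "\<dots> = 1600000 * ?S ^ 2" by (simp add: power2_eq_square)
  also have "\<dots> \<le> 3200000 * ?S ^ 12"
    using power_increasing[OF _ S(1), of 2 12] S(1) by (intro mult_mono) auto
  finally show ?thesis .
qed

end

section \<open>Arbitrary encodings and the final bounds\<close>

lemma encodes_list_input:
  assumes "Is \<noteq> []" "encodes_list w Is"
  obtains xs where "\<And>i. i < length Is \<Longrightarrow> Is ! i = (mset (xs i), snd (Is ! i))"
    "w = or_composition.input (length Is) (\<lambda>i. snd (Is ! i)) xs"
proof -
  interpret or_composition "length Is" "\<lambda>i. snd (Is ! i)" xs for xs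
    by standard (use assms(1) in simp)
  from assms(2) obtain ws where ws: "list_all2 encodes ws Is" "w = length Is # concat ws"
    by (auto simp: encodes_list_def)
  have "\<forall>i. \<exists>xs. i < length Is \<longrightarrow> mset xs = fst (Is ! i) \<and> ws ! i = snd (Is ! i) # length xs # xs"
    using ws(1) by (auto simp: list_all2_conv_all_nth encodes_def)
  then obtain xs where xs: "\<And>i. i < length Is \<Longrightarrow>
      mset (xs i) = fst (Is ! i) \<and> ws ! i = snd (Is ! i) # length (xs i) # xs i"
    by metis
  have "ws = map (\<lambda>i. snd (Is ! i) # length (xs i) # xs i) [0..<length Is]"
    using ws(1) xs by (auto simp: list_all2_conv_all_nth intro: nth_equalityI)
  then have "w = input xs"
    by (simp add: ws(2) input_def)
  with xs show thesis by (intro that) (auto simp: prod_eq_iff)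
qed

text \<open>The witnesses are \<open>or_prog\<close>, 3200000 and 12. The maxima with 1 keep the
  time bound positive for \<open>n = 0\<close> or \<open>t \<le> 1\<close>.\<close>

theorem theorem6:
  shows "\<exists>(P :: prog) (C :: nat) (c :: nat). \<forall>(Is :: subset_sum list) (w :: nat list).
    Is \<noteq> [] \<and> encodes_list w Is \<longrightarrow>
    (let N = length Is;
         n = Max ((\<lambda>I. size (fst I)) ` set Is);
         t = Max (snd ` set Is)
     in \<exists>(I0 :: subset_sum) (v :: nat list) (T :: nat).
          computes_in P w T v \<and> encodes v I0 \<and>
          real T \<le> real C * (real (max 1 n) * real N * max 1 (log 2 (real t))) ^ c \<and>
          size (fst I0) \<le> C * (n * N) \<and>
          snd I0 \<le> t * (C * (max 1 n * N) ^ c) \<and>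
          (yes_instance I0 \<longleftrightarrow> (\<exists>I \<in> set Is. yes_instance I)))"
proof (intro exI allI impI)
  fix Is :: "subset_sum list" and w
  assume "Is \<noteq> [] \<and> encodes_list w Is"
  then have "Is \<noteq> []" "encodes_list w Is" by auto
  then obtain xs where xs: "\<And>i. i < length Is \<Longrightarrow> Is ! i = (mset (xs i), snd (Is ! i))"
    and w: "w = or_composition.input (length Is) (\<lambda>i. snd (Is ! i)) xs"
    by (rule encodes_list_input) blast
  interpret or_composition "length Is" "\<lambda>i. snd (Is ! i)" xs
    by standard (use \<open>Is \<noteq> []\<close> in simp)
  have set_Is: "set Is = (\<lambda>i. Is ! i) ` {..<length Is}"
    by (auto simp: set_conv_nth)
  have size_eq: "size (fst (Is ! i)) = length (xs i)" if "i < length Is" for i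
    by (subst xs[OF that]) simp
  have t: "Max (snd ` set Is) = t"
    using Max_eq_pmax[OF N_pos, of "\<lambda>i. snd (Is ! i)"] by (simp add: set_Is image_image t_def)
  have "(\<lambda>I. size (fst I)) ` set Is = (\<lambda>i. length (xs i)) ` {..<length Is}"
    unfolding set_Is image_image using size_eq by (intro image_cong) auto
  then have n: "Max ((\<lambda>I. size (fst I)) ` set Is) = n"
    using Max_eq_pmax[OF N_pos, of "\<lambda>i. length (xs i)"] by (simp add: n_def)
  from runs_or_prog obtain m v T where v: "v = (if \<exists>i<length Is. snd (Is ! i) = 0 then [0, 0]
      else if n = 0 then [t, 0] else goal # length elems # elems)"
    and T: "T \<le> length Is * max 1 n * (20000 * width)"
    and exec: "exec input or_prog (\<lambda>_. 0, []) T (m, v)"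
    unfolding runs_def by blast
  have "computes_in or_prog w T v"
    using exec w by (auto simp: computes_in_def)
  moreover have "encodes v result"
    by (auto simp: v encodes_def result_def)
  moreover have "real T \<le> real 3200000 * (real (max 1 n) * real (length Is) * max 1 (log 2 (real t))) ^ 12"
    using order_trans[OF of_nat_mono[OF T] time_le] by simp
  moreover have "size (fst result) \<le> 3200000 * (n * length Is)"
    using size_result_le by linarith
  moreover have "snd result \<le> t * (3200000 * (max 1 n * length Is) ^ 12)"
    using result_target_le by (rule order_trans) simp
  moreover have "yes_instance result \<longleftrightarrow> (\<exists>I \<in> set Is. yes_instance I)"
  proof -
    have "yes_instance (Is ! i) \<longleftrightarrow> yes_instance (mset (xs i), snd (Is ! i))"
      if "i < length Is" for i
      by (rule arg_cong[OF xs[OF that]])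
    then show ?thesis
      unfolding yes_instance_result set_Is bex_simps by blast
  qed
  ultimately show "let N = length Is; n = Max ((\<lambda>I. size (fst I)) ` set Is); t = Max (snd ` set Is)
     in \<exists>I0 v T. computes_in or_prog w T v \<and> encodes v I0 \<and>
          real T \<le> real 3200000 * (real (max 1 n) * real N * max 1 (log 2 (real t))) ^ 12 \<and>
          size (fst I0) \<le> 3200000 * (n * N) \<and>
          snd I0 \<le> t * (3200000 * (max 1 n * N) ^ 12) \<and>
          (yes_instance I0 \<longleftrightarrow> (\<exists>I \<in> set Is. yes_instance I))"
    unfolding Let_def t n by blast
qed

end
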